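(* Let $k,l,m$ be positive integers, $n=(l+1)k$, and let $A\in\mathbb{R}^{m\times n}$ have $2k$-restricted isometry constant $\delta_{2k}\in[\frac{\sqrt{2}}{2},1)$. Let $x\in\mathbb{R}^n$, $\epsilon\ge 0$, $e\in\mathbb{R}^m$ with $\|e\|_2\le\epsilon$, and $y=Ax+e$. For $p\in(0,1)$ let $x^{\star}$ be a solution of $\min_{\gamma\in\mathbb{R}^n}\|\gamma\|_p$ subject to $\|y-A\gamma\|_2\le\epsilon$, and let $T_0^c=\{k+1,\dots,n\}$. Define $$C(p)=\begin{cases}\left(\dfrac{\big((2-\delta_{2k})^{1-\frac{2}{p}}+2\delta_{2k}\big)g(p)}{1-\delta_{2k}}\right)^{p/2}, & p\in(0,p^{\star}],\\[2ex] \left(\dfrac{(2-\delta_{2k})^{1-\frac{2}{p}}g(p)+2^{2-\frac{2}{p}}\delta_{2k}}{1-\delta_{2k}}\right)^{p/2}, & p\in(p^{\star},1),\end{cases}\qquad D(p)=\begin{cases}\left(\dfrac{(2+\delta_{2k})g(p)}{1-\delta_{2k}}\right)^{p/2}, & p\in(0,p^{\star}],\\[2ex] \left(\dfrac{(2-\delta_{2k})g(p)+2^{2-\frac{2}{p}}\delta_{2k}}{1-\delta_{2k}}\right)^{p/2}, & p\in(p^{\star},1).\end{cases}$$ Then for each $p\in(0,1)$ with $C(p)<1$, $$\|x-x^{\star}\|_2^p\le D_0k^{\frac{p}{2}-1}\|x_{T_0^c}\|_p^p+D_1\epsilon^p,\qquad D_0=\frac{2D(p)}{1-C(p)},\quad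 D_1=\frac{1}{(1-\delta_{2k})^{\frac p2}}\Big(2^p+\frac{2^{\frac{3p}{2}}D(p)}{1-C(p)}\Big).$$ In particular, if $\epsilon=0$ and $x$ is $k$-sparse, then $x^{\star}=x$.
   Context: For $1\le s\le n$, the $s$-restricted isometry constant $\delta_s$ of $A$ is the smallest constant such that $(1-\delta_s)\|z\|_2^2\le\|Az\|_2^2\le(1+\delta_s)\|z\|_2^2$ for all $s$-sparse $z\in\mathbb{R}^n$. For $p\in(0,1)$, $\|\gamma\|_p=(\sum_i|\gamma_i|^p)^{1/p}$. For a vector $v$ and index set $T$, $v_T$ is the vector equal to $v$ on $T$ and zero elsewhere. $g(p)=\frac{p}{2}(1-\frac{p}{2})^{\frac{2}{p}-1}$. $p^{\star}\approx0.45418$ is the unique solution in $(0,1]$ of $(\frac{p}{2})^{1/2}(2-p)^{\frac1p-\frac12}=1$. *)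

theory Defs
  imports Complex_Main
begin

text \<open>Vectors in R^n are functions nat => real, only indices 0..<n matter
  (0-based: paper index i corresponds to i-1).  A matrix in R^(m x n) is
  A :: nat => nat => real with A j i the (j,i) entry, j < m, i < n.\<close>

definition norm2 :: "nat \<Rightarrow> (nat \<Rightarrow> real) \<Rightarrow> real" where
  "norm2 n z = sqrt (\<Sum>i<n. (z i)\<^sup>2)"

definition pnorm :: "real \<Rightarrow> nat \<Rightarrow> (nat \<Rightarrow> real) \<Rightarrow> real" where
  "pnorm p n z = (\<Sum>i<n. \<bar>z i\<bar> powr p) powr (1 / p)"

definition matvec :: "nat \<Rightarrow> nat \<Rightarrow> (nat \<Rightarrow> nat \<Rightarrow> real) \<Rightarrow> (nat \<Rightarrow> real) \<Rightarrow> (nat \<Rightarrow> real)" where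
  "matvec m n A z = (\<lambda>j. if j < m then (\<Sum>i<n. A j i * z i) else 0)"

definition sparse :: "nat \<Rightarrow> nat \<Rightarrow> (nat \<Rightarrow> real) \<Rightarrow> bool" where
  "sparse s n z \<longleftrightarrow> card {i\<in>{..<n}. z i \<noteq> 0} \<le> s"

definition rip_const :: "nat \<Rightarrow> nat \<Rightarrow> (nat \<Rightarrow> nat \<Rightarrow> real) \<Rightarrow> nat \<Rightarrow> real" where
  "rip_const m n A s = Inf {d. \<forall>z. sparse s n z \<longrightarrow>
       (1 - d) * (norm2 n z)\<^sup>2 \<le> (norm2 m (matvec m n A z))\<^sup>2 \<and>
       (norm2 m (matvec m n A z))\<^sup>2 \<le> (1 + d) * (norm2 n z)\<^sup>2}"

definition gfun :: "real \<Rightarrow> real" where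
  "gfun p = p / 2 * (1 - p / 2) powr (2 / p - 1)"

definition pstar :: real where
  "pstar = (THE p. 0 < p \<and> p \<le> 1 \<and> sqrt (p / 2) * (2 - p) powr (1 / p - 1 / 2) = 1)"

definition Cfun :: "real \<Rightarrow> real \<Rightarrow> real" where
  "Cfun d p = (if p \<le> pstar
     then (((2 - d) powr (1 - 2 / p) + 2 * d) * gfun p / (1 - d)) powr (p / 2)
     else (((2 - d) powr (1 - 2 / p) * gfun p + 2 powr (2 - 2 / p) * d) / (1 - d)) powr (p / 2))"

definition Dfun :: "real \<Rightarrow> real \<Rightarrow> real" where
  "Dfun d p = (if p \<le> pstar
     then ((2 + d) * gfun p / (1 - d)) powr (p / 2)
     else (((2 - d) * gfun p + 2 powr (2 - 2 / p) * d) / (1 - d)) powr (p / 2))"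

end

theory Submission
  imports Defs "HOL-Analysis.Convex" "HOL-Analysis.L2_Norm" "HOL-Combinatorics.Permutations"
begin

text \<open>Let \<open>h = x - x\<^sup>\<star>\<close>, sort \<open>\<bar>h\<bar>\<close> decreasingly and cut it into blocks \<open>h\<^sub>0, \<dots>, h\<^sub>l\<close> of length \<open>k\<close>.
  Put \<open>N = k powr (1 - 2/p) \<parallel>h - h\<^sub>0\<parallel>\<^sub>p\<^sup>2\<close> and \<open>M = max (g(p)) (2 powr (1 - 2/p))\<close>; the point \<open>p\<^sup>\<star>\<close> is where the maximum
  switches. By polarisation the image of the tail \<open>h\<^sub>2 + \<dots> + h\<^sub>l\<close> has energy at most
  \<open>(\<Sum>\<parallel>h\<^sub>j\<parallel>\<^sup>2) + \<delta> (\<Sum>\<parallel>h\<^sub>j\<parallel>)\<^sup>2\<close>, the sums running over \<open>j \<ge> 2\<close>. A weighted form of Stechkin's inequality gives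
  \<open>(\<Sum>\<parallel>h\<^sub>j\<parallel>\<^sup>2) - (a - 1) \<parallel>h\<^sub>1\<parallel>\<^sup>2 \<le> a powr (1 - 2/p) g(p) N\<close> (used with \<open>a = 1\<close> and \<open>a = 2 - \<delta>\<close>), and
  convexity in the variable \<open>\<bar>h\<bar>\<^sup>p\<close> reduces \<open>(\<Sum>\<parallel>h\<^sub>j\<parallel>)\<^sup>2 \<le> 2 M N\<close> to vectors that are constant on an
  initial segment. Since \<open>p < 1\<close>, the noise can be split off after raising to the power \<open>p\<close>, and
  the optimality of \<open>x\<^sup>\<star>\<close> enters through the cone condition.\<close>

section \<open>The function \<open>g\<close> and the threshold exponent\<close>

lemma gfun_max:
  assumes "0 < p" "p < 2" "0 \<le> s"
  shows "s powr (2 / p - 1) * (1 - s) \<le> gfun p"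
proof (cases "0 < s \<and> s < 1")
  case True
  \<comment> \<open>Both quotients equal 1 at the maximiser, and their mean with weights
    \<open>1 - p / 2\<close> and \<open>p / 2\<close> is 1 for every \<open>s\<close>.\<close>
  define x where "x = s / (1 - p / 2)"
  define y where "y = (1 - s) / (p / 2)"
  have pos: "x > 0" "y > 0"
    using True assms by (auto simp: x_def y_def)
  have "x powr (1 - p / 2) * y powr (p / 2) \<le> (1 - p / 2) * x + (p / 2) * y"
    by (rule Youngs_inequality_0) (use assms pos in auto)
  also have "\<dots> = 1"
    using assms by (simp add: x_def y_def field_simps)
  finally have "(x powr (1 - p / 2) * y powr (p / 2)) powr (2 / p) \<le> 1 powr (2 / p)"
    using assms by (intro powr_mono2) auto
  moreover have "(1 - p / 2) * (2 / p) = 2 / p - 1" "(p / 2) * (2 / p) = 1"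
    using assms by (simp_all add: field_simps)
  ultimately have "x powr (2 / p - 1) * y \<le> 1"
    using pos by (simp add: powr_mult powr_powr)
  then have "(x powr (2 / p - 1) * y) * gfun p \<le> 1 * gfun p"
    using assms by (intro mult_right_mono) (auto simp: gfun_def)
  moreover have "s = x * (1 - p / 2)" "1 - s = y * (p / 2)"
    using assms by (simp_all add: x_def y_def)
  then have "s powr (2 / p - 1) * (1 - s) = (x powr (2 / p - 1) * y) * gfun p"
    using pos assms by (simp only: powr_mult gfun_def) simp
  ultimately show ?thesis
    by simp
next
  case False
  moreover have "gfun p \<ge> 0"
    using assms by (simp add: gfun_def)
  ultimately show ?thesis
    using assms by (cases "s = 0") (auto intro: order_trans[OF mult_nonneg_nonpos])
qed

lemma gfun_pos: "0 < p \<Longrightarrow> p < 2 \<Longrightarrow> 0 < gfun p"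
  by (simp add: gfun_def)

text \<open>Twice the logarithm of the expression that \<open>pstar\<close> sets equal to 1.\<close>

definition logpsi :: "real \<Rightarrow> real" where
  "logpsi p = ln (p / 2) + (2 / p - 1) * ln (2 - p)"

text \<open>The rational terms of the derivative cancel; what remains is negative for
  \<open>p < 1\<close>.\<close>

lemma logpsi_deriv:
  assumes "0 < p" "p < 2"
  shows "(logpsi has_real_derivative - (2 / p\<^sup>2) * ln (2 - p)) (at p)"
  unfolding logpsi_def
  by (rule derivative_eq_intros refl | use assms in \<open>simp add: field_simps power2_eq_square\<close>)+

lemma logpsi_strict_antimono:
  assumes "0 < p" "p < q" "q \<le> 1"
  shows "logpsi q < logpsi p"
proof (rule DERIV_neg_imp_decreasing_open[OF assms(2)])
  show "\<exists>y. (logpsi has_real_derivative y) (at x) \<and> y < 0" if "p < x" "x < q" for x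
    using logpsi_deriv[of x] that assms by (intro exI conjI) auto
  show "continuous_on {p..q} logpsi"
    using assms by (intro continuous_at_imp_continuous_on ballI DERIV_isCont[OF logpsi_deriv]) auto
qed

lemma pstar_eq_iff:
  assumes "0 < p" "p \<le> 1"
  shows "sqrt (p / 2) * (2 - p) powr (1 / p - 1 / 2) = 1 \<longleftrightarrow> logpsi p = 0"
proof -
  have "ln (sqrt (p / 2) * (2 - p) powr (1 / p - 1 / 2)) = logpsi p / 2"
    using assms by (simp add: ln_mult ln_sqrt ln_powr logpsi_def algebra_simps)
  moreover have "sqrt (p / 2) * (2 - p) powr (1 / p - 1 / 2) > 0"
    using assms by simp
  ultimately show ?thesis
    by (metis ln_eq_zero_iff divide_eq_0_iff zero_neq_numeral)
qed

text \<open>The intermediate value theorem gives a root and strict monotonicity its uniqueness; both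
  are needed before \<open>THE\<close> in \<open>pstar\<close> denotes anything.\<close>

lemma pstar_root: "0 < pstar" "pstar \<le> 1" "logpsi pstar = 0"
proof -
  have "\<exists>p\<ge>1/4. p \<le> 1 \<and> logpsi p = 0"
  proof (rule IVT2)
    show "logpsi 1 \<le> 0"
      by (simp add: logpsi_def ln_le_zero_iff)
    \<comment> \<open>The right-hand side is \<open>exp (logpsi (1 / 4))\<close>.\<close>
    have "(1::real) \<le> (1 / 8) * (7 / 4) ^ 7"
      by (simp add: power_divide)
    then have "0 \<le> ln ((1 / 8) * (7 / 4 :: real) ^ 7)"
      by (rule ln_ge_zero)
    also have "\<dots> = ln (1 / 8) + 7 * ln (7 / 4)"
      by (subst ln_mult) (simp_all only: ln_realpow, simp_all)
    also have "\<dots> = logpsi (1 / 4)"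
      by (simp add: logpsi_def)
    finally show "0 \<le> logpsi (1 / 4)" .
    show "\<forall>x. 1 / 4 \<le> x \<and> x \<le> 1 \<longrightarrow> isCont logpsi x"
      by (auto intro!: DERIV_isCont[OF logpsi_deriv])
  qed auto
  then obtain p where p: "0 < p" "p \<le> 1" "logpsi p = 0"
    by force
  have "\<exists>!p. 0 < p \<and> p \<le> 1 \<and> sqrt (p / 2) * (2 - p) powr (1 / p - 1 / 2) = 1"
  proof (rule ex1I[of _ p])
    show "0 < p \<and> p \<le> 1 \<and> sqrt (p / 2) * (2 - p) powr (1 / p - 1 / 2) = 1"
      using p pstar_eq_iff by blast
    show "q = p" if "0 < q \<and> q \<le> 1 \<and> sqrt (q / 2) * (2 - q) powr (1 / q - 1 / 2) = 1" for q
      using that p logpsi_strict_antimono pstar_eq_iff by (metis less_irrefl linorder_neqE_linordered_idom)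
  qed
  from theI'[OF this] show "0 < pstar" "pstar \<le> 1" "logpsi pstar = 0"
    unfolding pstar_def[symmetric] using pstar_eq_iff by blast+
qed

text \<open>Extracting the powers of 2 turns the comparison of \<open>gfun p\<close> with
  \<open>2 powr (1 - 2 / p)\<close> into the sign of \<open>logpsi p\<close>.\<close>

lemma gfun_logpsi:
  assumes "0 < p" "p < 2"
  shows "gfun p = 2 powr (1 - 2 / p) * exp (logpsi p)"
proof -
  have halve: "(x / 2) powr q = x powr q * 2 powr - q" if "0 \<le> x" for x q :: real
    using that by (simp add: powr_divide powr_minus_divide)
  have "(1 - p / 2) powr (2 / p - 1) = ((2 - p) / 2) powr (2 / p - 1)"
    by (simp add: diff_divide_distrib)
  also have "\<dots> = (2 - p) powr (2 / p - 1) * 2 powr - (2 / p - 1)"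
    using halve[of "2 - p"] assms by simp
  also have "- (2 / p - 1) = 1 - 2 / p"
    by simp
  finally have "(1 - p / 2) powr (2 / p - 1) = (2 - p) powr (2 / p - 1) * 2 powr (1 - 2 / p)" .
  moreover have "exp (logpsi p) = p / 2 * (2 - p) powr (2 / p - 1)"
    using assms by (simp add: logpsi_def exp_add powr_def)
  ultimately show ?thesis
    by (simp add: gfun_def)
qed

text \<open>\<open>logpsi\<close> decreases strictly and vanishes at \<open>pstar\<close>. This
  accounts for the two branches of \<open>Cfun\<close> and \<open>Dfun\<close>.\<close>

lemma gfun_pstar:
  assumes "0 < p" "p < 1"
  shows "max (gfun p) (2 powr (1 - 2 / p)) = (if p \<le> pstar then gfun p else 2 powr (1 - 2 / p))"
proof (cases "p \<le> pstar")
  case True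
  then have "0 \<le> logpsi p"
    using logpsi_strict_antimono[of p pstar] pstar_root assms by (cases "p = pstar") auto
  then show ?thesis
    using True assms by (simp add: gfun_logpsi)
next
  case False
  then have "logpsi p \<le> 0"
    using logpsi_strict_antimono[of pstar p] pstar_root assms by auto
  then show ?thesis
    using False assms by (simp add: gfun_logpsi max_def mult_le_cancel_left1)
qed

section \<open>Tails of decreasing sequences\<close>

text \<open>With \<open>t = c (k - 1)\<close>, each square is at most
  \<open>t powr (2 - p) * c i powr p\<close> behind the head and at least that inside it. For
  \<open>a > 1\<close> the energy of the head pays for part of the tail.\<close>

lemma stechkin:
  fixes c :: "nat \<Rightarrow> real"
  assumes p: "0 < p" "p < 2" and a: "1 \<le> a" and k: "0 < k" "k \<le> N"
    and nonneg: "\<And>i. i < N \<Longrightarrow> 0 \<le> c i"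
    and dec: "\<And>i j. i \<le> j \<Longrightarrow> j < N \<Longrightarrow> c j \<le> c i"
  shows "(\<Sum>i=k..<N. (c i)\<^sup>2) - (a - 1) * (\<Sum>i<k. (c i)\<^sup>2)
    \<le> a powr (1 - 2 / p) * gfun p * real k powr (1 - 2 / p) * (\<Sum>i<N. c i powr p) powr (2 / p)"
proof -
  define t where "t = c (k - 1)"
  define P where "P = (\<Sum>i<k. c i powr p)"
  define B where "B = (\<Sum>i=k..<N. c i powr p)"
  define Z where "Z = (\<Sum>i<N. c i powr p)"
  have t0: "0 \<le> t"
    using k by (auto simp: t_def intro: nonneg)
  have split: "Z = P + B"
    unfolding Z_def P_def B_def using k
    by (simp add: sum.atLeastLessThan_concat[of 0 k N, symmetric] lessThan_atLeast0)
  have sq: "(c i)\<^sup>2 = c i powr (2 - p) * c i powr p" if "i < N" for i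
    using nonneg[OF that] by (cases "c i = 0") (simp_all flip: powr_add)
  have up: "(\<Sum>i=k..<N. (c i)\<^sup>2) \<le> t powr (2 - p) * B"
    unfolding B_def sum_distrib_left
  proof (rule sum_mono)
    fix i assume i: "i \<in> {k..<N}"
    then have "c i \<le> t" "0 \<le> c i"
      using dec[of "k - 1" i] nonneg[of i] by (auto simp: t_def)
    then show "(c i)\<^sup>2 \<le> t powr (2 - p) * c i powr p"
      using sq[of i] i p by (auto intro!: mult_right_mono powr_mono2)
  qed
  have low: "t powr (2 - p) * P \<le> (\<Sum>i<k. (c i)\<^sup>2)"
    unfolding P_def sum_distrib_left
  proof (rule sum_mono)
    fix i assume i: "i \<in> {..<k}"
    then have "t \<le> c i"
      using dec[of i "k - 1"] k by (auto simp: t_def)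
    then show "t powr (2 - p) * c i powr p \<le> (c i)\<^sup>2"
      using sq[of i] i p k t0 by (auto intro!: mult_right_mono powr_mono2)
  qed
  have "(\<Sum>i<k. t powr p) \<le> P"
    unfolding P_def
    using dec[of _ "k - 1"] k t0 p by (intro sum_mono powr_mono2) (auto simp: t_def)
  then have P: "k * t powr p \<le> P"
    by simp
  have "(\<Sum>i=k..<N. (c i)\<^sup>2) - (a - 1) * (\<Sum>i<k. (c i)\<^sup>2)
      \<le> t powr (2 - p) * B - (a - 1) * (t powr (2 - p) * P)"
    using up low a by (intro diff_mono mult_left_mono) auto
  also have "\<dots> = t powr (2 - p) * (Z - a * P)"
    by (simp add: split algebra_simps)
  \<comment> \<open>Head terms are at least \<open>t powr p\<close>; afterwards only
    \<open>t\<close> and \<open>Z\<close> are left as variables.\<close>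
  also have "\<dots> \<le> t powr (2 - p) * (Z - a * (k * t powr p))"
    using P a by (intro mult_left_mono diff_left_mono) auto
  also have "\<dots> \<le> a powr (1 - 2 / p) * gfun p * real k powr (1 - 2 / p) * Z powr (2 / p)"
  proof (cases "t = 0")
    case True
    then show ?thesis
      using gfun_pos[OF p] p by simp
  next
    case False
    then have t: "0 < t"
      using t0 by simp
    have "0 < P"
      by (rule less_le_trans[OF _ P]) (use t k in simp)
    moreover have "0 \<le> B"
      by (simp add: B_def sum_nonneg)
    ultimately have Z: "0 < Z"
      by (simp add: split)
    \<comment> \<open>In this variable the bound is a constant times
      \<open>s powr (2 / p - 1) * (1 - s)\<close>.\<close>
    define s where "s = a * k * t powr p / Z"
    have s: "0 < s"
      using t a k Z by (simp add: s_def)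
    have tp: "t powr p = s * Z / (a * k)"
      using Z a k by (simp add: s_def)
    have "t powr (2 - p) = (t powr p) powr (2 / p - 1)"
      using p by (simp add: powr_powr algebra_simps)
    also have "\<dots> = s powr (2 / p - 1) * Z powr (2 / p - 1) * (a powr (1 - 2 / p) * k powr (1 - 2 / p))"
      unfolding tp using s Z a k
      by (simp add: powr_divide powr_mult powr_diff)
    finally have tp2: "t powr (2 - p) = s powr (2 / p - 1) * Z powr (2 / p - 1) * (a powr (1 - 2 / p) * k powr (1 - 2 / p))" .
    have "Z - a * (k * t powr p) = Z * (1 - s)"
      using Z by (simp add: s_def field_simps)
    then have "t powr (2 - p) * (Z - a * (k * t powr p)) =
       (a powr (1 - 2 / p) * k powr (1 - 2 / p) * (Z powr (2 / p - 1) * Z)) * (s powr (2 / p - 1) * (1 - s))"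
      by (simp add: tp2 algebra_simps)
    also have "\<dots> \<le> (a powr (1 - 2 / p) * k powr (1 - 2 / p) * (Z powr (2 / p - 1) * Z)) * gfun p"
      using s p Z by (intro mult_left_mono gfun_max) auto
    also have "Z powr (2 / p - 1) * Z = Z powr (2 / p)"
      using Z by (simp add: powr_diff)
    finally show ?thesis
      by (simp add: algebra_simps)
  qed
  finally show ?thesis
    by (simp add: Z_def)
qed

section \<open>Flat sequences, Jensen's inequality and the sum of the block norms\<close>

lemma convex_on_powr_nonneg:
  assumes "1 \<le> q"
  shows "convex_on {0..} (\<lambda>x::real. x powr q)"
proof (rule convex_onI)
  have scale: "(t * y) powr q \<le> t * y powr q" if "0 < t" "t < 1" "0 \<le> y" for t y :: real
  proof -
    have "t powr q \<le> t powr 1"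
      using that assms by (intro powr_mono') auto
    then show ?thesis
      using that by (simp add: powr_mult mult_right_mono)
  qed
  show "((1 - t) *\<^sub>R x + t *\<^sub>R y) powr q \<le> (1 - t) * x powr q + t * y powr q"
    if "0 < t" "t < 1" "x \<in> {0..}" "y \<in> {0..}" for t x y :: real
  proof (cases "0 < x \<and> 0 < y")
    case True
    then show ?thesis
      using convex_onD[OF powr_convex[OF assms], of t x y] that by simp
  next
    case False
    then show ?thesis
      using that scale[of t y] scale[of "1 - t" x] assms by (cases "x = 0") auto
  qed
qed simp

text \<open>Summation by parts; with \<open>b N = 0\<close> it shows that the layer weights below
  have total 1.\<close>

lemma sum_layer_cake:
  fixes b :: "nat \<Rightarrow> real"
  shows "(\<Sum>r=1..N. real r * (b (r - 1) - b r)) = (\<Sum>i<N. b i) - N * b N"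
  by (induction N) (simp_all add: algebra_simps)

lemma sum_tail_telescope:
  fixes b :: "nat \<Rightarrow> real"
  assumes "i \<le> N"
  shows "(\<Sum>r=1..N. if i < r then b (r - 1) - b r else 0) = b i - b N"
  using assms by (induction rule: dec_induct) auto

text \<open>A decreasing sequence is a convex combination, in the variable \<open>c\<^sup>p\<close>, of
  sequences that are constant on an initial segment; Jensen moves the combination to \<open>c\<close>.\<close>

lemma decreasing_le_flat_combination:
  fixes c :: "nat \<Rightarrow> real"
  assumes p: "0 < p" "p \<le> 1"
    and nonneg: "\<And>i. i < N \<Longrightarrow> 0 \<le> c i"
    and dec: "\<And>i j. i \<le> j \<Longrightarrow> j < N \<Longrightarrow> c j \<le> c i"
    and Z: "Z = (\<Sum>i<N. c i powr p)" "0 < Z"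
  obtains w :: "nat \<Rightarrow> real" where "\<And>r. r \<in> {1..N} \<Longrightarrow> 0 \<le> w r" "(\<Sum>r=1..N. w r) = 1"
    "\<And>i. i < N \<Longrightarrow> c i \<le> (\<Sum>r=1..N. w r * (if i < r then (Z / real r) powr (1 / p) else 0))"
proof
  \<comment> \<open>The value 0 at \<open>N\<close> makes the last entry count as a full drop, so
    the drops telescope to \<open>b i\<close>.\<close>
  define b where "b i = (if i < N then c i powr p else 0)" for i
  \<comment> \<open>The layer on the first \<open>r\<close> indices has height
    \<open>b (r - 1) - b r\<close>; \<open>w r\<close> is its share of the total mass
    \<open>Z\<close>.\<close>
  define w where "w r = real r * (b (r - 1) - b r) / Z" for r
  have bN: "b N = 0" and sb: "(\<Sum>i<N. b i) = Z"
    by (simp_all add: b_def Z)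
  show w0: "0 \<le> w r" if "r \<in> {1..N}" for r
  proof -
    have "b r \<le> b (r - 1)"
      using that dec[of "r - 1" r] nonneg[of r] p by (auto simp: b_def intro!: powr_mono2)
    then show ?thesis
      using Z by (simp add: w_def)
  qed
  show w1: "(\<Sum>r=1..N. w r) = 1"
    using Z(2) sum_layer_cake[of b N] by (simp add: w_def bN sb flip: sum_divide_distrib)
  fix i assume i: "i < N"
  have "w r * (if i < r then Z / real r else 0) = (if i < r then b (r - 1) - b r else 0)" for r
    using Z(2) by (simp add: w_def)
  then have bi: "b i = (\<Sum>r=1..N. w r *\<^sub>R (if i < r then Z / real r else 0))"
    using sum_tail_telescope[of i N b] i by (simp add: bN)
  have "c i = b i powr (1 / p)"
    using i p nonneg[OF i] by (simp add: b_def powr_powr)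
  \<comment> \<open>Jensen for the exponent \<open>1 / p \<ge> 1\<close>.\<close>
  also have "\<dots> \<le> (\<Sum>r=1..N. w r * (if i < r then Z / real r else 0) powr (1 / p))"
    unfolding bi using i p w0 w1 Z(2)
    by (intro convex_on_sum[OF _ _ convex_on_powr_nonneg]) auto
  finally show "c i \<le> (\<Sum>r=1..N. w r * (if i < r then (Z / real r) powr (1 / p) else 0))"
    using p by (simp add: if_distrib[of "\<lambda>x. x powr (1 / p)"] cong: if_cong)
qed

lemma L2_set_sum_le: "L2_set (\<lambda>i. \<Sum>r\<in>R. f r i) S \<le> (\<Sum>r\<in>R. L2_set (f r) S)"
proof (cases "finite R")
  case True
  then show ?thesis
    by induction (auto simp: L2_set_0' intro: order_trans[OF L2_set_triangle_ineq])
qed (simp add: L2_set_0')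

text \<open>Truncated subtraction gives 0 for a block that lies entirely beyond
  \<open>r\<close>.\<close>

lemma L2_set_flat:
  fixes a b r :: nat
  shows "L2_set (\<lambda>i. if i < r then t else 0) {a..<b} = sqrt (real (min b r - a)) * \<bar>t\<bar>"
proof -
  have "(\<Sum>i=a..<b. (if i < r then t else 0)\<^sup>2) = (\<Sum>i\<in>{a..<b} \<inter> {..<r}. t\<^sup>2)"
    by (subst sum.inter_restrict) (auto intro!: sum.cong)
  also have "{a..<b} \<inter> {..<r} = {a..<min b r}"
    by auto
  finally show ?thesis
    by (simp add: L2_set_def real_sqrt_mult)
qed

text \<open>The extremal case of the block estimate: a flat sequence of length \<open>r\<close>. For
  \<open>r \<le> 2 * k\<close> only block 1 can contribute and \<open>gfun p\<close> governs; for
  longer ones about \<open>r / k\<close> blocks contribute and \<open>2 powr (1 - 2 / p)\<close>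
  governs.\<close>

lemma flat_block_sum:
  assumes p: "0 < p" "p < 1" and k: "0 < k" and r: "0 < r"
  shows "(\<Sum>j=1..<l. sqrt (real (min (Suc j * k) r - j * k)))\<^sup>2
    \<le> 2 * max (gfun p) (2 powr (1 - 2 / p)) * k * (r / k) powr (2 / p)"
    (is "(\<Sum>j=1..<l. ?s j)\<^sup>2 \<le> 2 * ?M * real k * _")
proof -
  have M: "gfun p \<le> ?M" "2 powr (1 - 2 / p) \<le> ?M" "0 \<le> ?M"
    by (auto simp: le_max_iff_disj)
  have rk: "0 < r / real k"
    using k r by simp
  show ?thesis
  proof (cases "r \<le> 2 * k")
    case True
    have "?s j \<le> (if j = 1 then sqrt (real (r - k)) else 0)" if "1 \<le> j" for j
    proof (cases "j = 1")
      case False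
      then have "2 * k \<le> j * k"
        using that by (intro mult_right_mono) auto
      then have "r \<le> j * k"
        using True by linarith
      then show ?thesis
        using False by simp
    qed auto
    then have "(\<Sum>j=1..<l. ?s j) \<le> (\<Sum>j=1..<l. if j = 1 then sqrt (real (r - k)) else 0)"
      by (intro sum_mono) simp
    also have "\<dots> \<le> sqrt (real (r - k))"
      by (simp add: sum.delta)
    finally have "(\<Sum>j=1..<l. ?s j)\<^sup>2 \<le> (sqrt (real (r - k)))\<^sup>2"
      by (intro power_mono sum_nonneg) auto
    also have "\<dots> = real (r - k)"
      by simp
    also have "\<dots> \<le> gfun p * k * (r / k) powr (2 / p)"
    proof (cases "r \<le> k")
      case True
      then show ?thesis
        using gfun_pos[of p] p by simp
    next
      case False
      \<comment> \<open>The inequality for \<open>gfun\<close> at \<open>s = k / r\<close>, since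
        \<open>r - k\<close> is \<open>r * (1 - k / r)\<close>.\<close>
      have "(k / r) powr (2 / p - 1) * (1 - k / r) \<le> gfun p"
        using p by (intro gfun_max) auto
      also have "(k / r) powr (2 / p - 1) = (r / k) * inverse ((r / k) powr (2 / p))"
        using k r by (simp add: powr_diff powr_divide mult.commute)
      finally have "(r / k) * (1 - k / r) \<le> gfun p * (r / k) powr (2 / p)"
        using k r by (simp add: field_simps)
      then have "k * ((r / k) * (1 - k / r)) \<le> k * (gfun p * (r / k) powr (2 / p))"
        by (rule mult_left_mono) simp
      moreover have "k * ((r / k) * (1 - k / r)) = real (r - k)"
        using k r False by (simp add: field_simps of_nat_diff)
      ultimately show ?thesis
        by (simp add: algebra_simps)
    qed
    also have "\<dots> \<le> (2 * ?M) * k * (r / k) powr (2 / p)"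
      using M by (intro mult_right_mono) auto
    finally show ?thesis
      by simp
  next
    case False
    have "?s j \<le> (if j \<in> {1..r div k} then sqrt k else 0)" if "1 \<le> j" for j
    proof (cases "j \<le> r div k")
      case True
      then show ?thesis
        using that by auto
    next
      case False
      then have "r < j * k"
        using k by (simp add: div_less_iff_less_mult not_le)
      then show ?thesis
        using False by simp
    qed
    then have "(\<Sum>j=1..<l. ?s j) \<le> (\<Sum>j=1..<l. if j \<in> {1..r div k} then sqrt k else 0)"
      by (intro sum_mono) simp
    also have "\<dots> = (\<Sum>j\<in>{1..<l} \<inter> {1..r div k}. sqrt k)"
      by (rule sum.inter_restrict[symmetric]) simp
    also have "\<dots> \<le> (\<Sum>j=1..r div k. sqrt k)"
      by (intro sum_mono2) auto
    also have "\<dots> = real (r div k) * sqrt k"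
      by simp
    also have "\<dots> \<le> (r / k) * sqrt k"
      by (intro mult_right_mono of_nat_div_le_of_nat) auto
    finally have "(\<Sum>j=1..<l. ?s j)\<^sup>2 \<le> ((r / k) * sqrt k)\<^sup>2"
      by (intro power_mono sum_nonneg) auto
    also have "\<dots> = (r / k)\<^sup>2 * k"
      unfolding power_mult_distrib by simp
    also have "\<dots> \<le> 2 * 2 powr (1 - 2 / p) * (r / k) powr (2 / p) * k"
    proof (rule mult_right_mono)
      have q: "2 \<le> r / real k"
        using False k by (simp add: field_simps)
      \<comment> \<open>The base \<open>r / (2 * k)\<close> is at least 1 and the exponent
        \<open>2 / p\<close> at least 2; dividing by 2 first is what produces the factor
        \<open>2 powr (1 - 2 / p)\<close>.\<close>
      have "(r / real k / 2) powr 2 \<le> (r / real k / 2) powr (2 / p)"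
        using q p by (intro powr_mono) (auto simp: field_simps)
      moreover have "(r / real k / 2) powr (2 / p) = (r / k) powr (2 / p) / 2 powr (2 / p)"
        using q by (simp only: powr_divide)
      ultimately have "(r / real k)\<^sup>2 \<le> 4 * ((r / k) powr (2 / p) / 2 powr (2 / p))"
        using rk by (simp add: power_divide)
      then show "(r / real k)\<^sup>2 \<le> 2 * 2 powr (1 - 2 / p) * (r / k) powr (2 / p)"
        by (simp add: powr_diff)
    qed simp
    also have "\<dots> \<le> 2 * ?M * (r / k) powr (2 / p) * k"
      using M by (intro mult_right_mono mult_left_mono) auto
    finally show ?thesis
      by (simp add: algebra_simps)
  qed
qed

lemma block_less: "j < l \<Longrightarrow> i < Suc j * k \<Longrightarrow> i < l * k" for i j k l :: nat
  using mult_le_mono1[of "Suc j" l k] by linarith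

text \<open>The sum of block norms is monotone in nonnegative entries and subadditive, so a convex
  combination of flat sequences is no worse than the worst of them.\<close>

lemma block_norm_sum:
  fixes c :: "nat \<Rightarrow> real"
  assumes p: "0 < p" "p < 1" and k: "0 < k"
    and nonneg: "\<And>i. i < l * k \<Longrightarrow> 0 \<le> c i"
    and dec: "\<And>i j. i \<le> j \<Longrightarrow> j < l * k \<Longrightarrow> c j \<le> c i"
  shows "(\<Sum>j=1..<l. L2_set c {j * k..<Suc j * k})\<^sup>2
    \<le> 2 * max (gfun p) (2 powr (1 - 2 / p)) * (real k powr (1 - 2 / p) * (\<Sum>i<l * k. c i powr p) powr (2 / p))"
    (is "_ \<le> 2 * ?M * (_ * ?Z powr _)")
proof (cases "?Z = 0")
  case True
  then have "c i = 0" if "i < l * k" for i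
    using that by (auto simp: sum_nonneg_eq_0_iff)
  moreover have "i < l * k" if "j \<in> {1..<l}" "i \<in> {j * k..<Suc j * k}" for i j
    using that block_less[of j l i k] by simp
  ultimately have "(\<Sum>j=1..<l. L2_set c {j * k..<Suc j * k}) = 0"
    by (intro sum.neutral ballI L2_set_0') blast
  then show ?thesis
    using True p by simp
next
  case False
  then have Z: "0 < ?Z"
    by (simp add: sum_nonneg less_le)
  define K where "K = sqrt (2 * ?M * (real k powr (1 - 2 / p) * ?Z powr (2 / p)))"
  have M: "0 \<le> ?M"
    by (simp add: le_max_iff_disj)
  obtain w where w: "\<And>r. r \<in> {1..l * k} \<Longrightarrow> 0 \<le> w r" "(\<Sum>r=1..l * k. w r) = 1"
    "\<And>i. i < l * k \<Longrightarrow> c i \<le> (\<Sum>r=1..l * k. w r * (if i < r then (?Z / real r) powr (1 / p) else 0))"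
    using decreasing_le_flat_combination[OF p(1) less_imp_le[OF p(2)] nonneg dec refl Z] by blast
  let ?f = "\<lambda>r i. if i < r then (?Z / real r) powr (1 / p) else 0"
  have flat: "(\<Sum>j=1..<l. L2_set (?f r) {j * k..<Suc j * k}) \<le> K" if r: "0 < r" for r
  proof -
    have "(\<Sum>j=1..<l. L2_set (?f r) {j * k..<Suc j * k})
        = (\<Sum>j=1..<l. sqrt (real (min (Suc j * k) r - j * k))) * (?Z / real r) powr (1 / p)"
      by (simp only: L2_set_flat sum_distrib_right) simp
    moreover have "((\<Sum>j=1..<l. sqrt (real (min (Suc j * k) r - j * k))) * (?Z / real r) powr (1 / p))\<^sup>2
        \<le> (2 * ?M * k * (r / k) powr (2 / p)) * (?Z / real r) powr (2 / p)"
      unfolding power_mult_distrib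
    proof (rule mult_mono)
      show "((?Z / real r) powr (1 / p))\<^sup>2 \<le> (?Z / real r) powr (2 / p)"
        using Z r by (simp add: powr_powr flip: powr_numeral)
    qed (use flat_block_sum[OF p k r] M in auto)
    moreover have "(2 * ?M * k * (r / k) powr (2 / p)) * (?Z / real r) powr (2 / p)
        = 2 * ?M * (real k powr (1 - 2 / p) * ?Z powr (2 / p))"
      using Z r k by (simp add: powr_divide powr_diff)
    ultimately show ?thesis
      unfolding K_def by (intro real_le_rsqrt) simp
  qed
  have "(\<Sum>j=1..<l. L2_set c {j * k..<Suc j * k})
      \<le> (\<Sum>j=1..<l. \<Sum>r=1..l * k. w r * L2_set (?f r) {j * k..<Suc j * k})"
  proof (rule sum_mono)
    fix j assume j: "j \<in> {1..<l}"
    have lt: "i < l * k" if "i \<in> {j * k..<Suc j * k}" for i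
      using that j block_less[of j l i k] by simp
    have "L2_set c {j * k..<Suc j * k} \<le> L2_set (\<lambda>i. \<Sum>r=1..l * k. w r * ?f r i) {j * k..<Suc j * k}"
      using w(3) nonneg lt by (intro L2_set_mono) auto
    also have "\<dots> \<le> (\<Sum>r=1..l * k. L2_set (\<lambda>i. w r * ?f r i) {j * k..<Suc j * k})"
      by (rule L2_set_sum_le)
    also have "\<dots> = (\<Sum>r=1..l * k. w r * L2_set (?f r) {j * k..<Suc j * k})"
      using w(1) by (intro sum.cong refl L2_set_right_distrib[symmetric])
    finally show "L2_set c {j * k..<Suc j * k} \<le> \<dots>" .
  qed
  also have "\<dots> = (\<Sum>r=1..l * k. w r * (\<Sum>j=1..<l. L2_set (?f r) {j * k..<Suc j * k}))"
    by (subst sum.swap) (simp add: sum_distrib_left)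
  also have "\<dots> \<le> (\<Sum>r=1..l * k. w r * K)"
    using w(1) flat by (intro sum_mono mult_left_mono) auto
  also have "\<dots> = K"
    using w(2) by (simp flip: sum_distrib_right)
  finally have "(\<Sum>j=1..<l. L2_set c {j * k..<Suc j * k})\<^sup>2 \<le> K\<^sup>2"
    by (intro power_mono sum_nonneg) auto
  then show ?thesis
    using M by (simp add: K_def)
qed

section \<open>Restricted isometries\<close>

definition restr :: "nat set \<Rightarrow> (nat \<Rightarrow> real) \<Rightarrow> nat \<Rightarrow> real" where
  "restr S z = (\<lambda>i. if i \<in> S then z i else 0)"

text \<open>The condition on \<open>d\<close> inside \<open>rip_const\<close>, detached from the
  infimum.\<close>

definition rip :: "nat \<Rightarrow> nat \<Rightarrow> (nat \<Rightarrow> nat \<Rightarrow> real) \<Rightarrow> nat \<Rightarrow> real \<Rightarrow> bool" where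
  "rip m n A s d \<longleftrightarrow> (\<forall>z. sparse s n z \<longrightarrow>
     (1 - d) * (norm2 n z)\<^sup>2 \<le> (norm2 m (matvec m n A z))\<^sup>2 \<and>
     (norm2 m (matvec m n A z))\<^sup>2 \<le> (1 + d) * (norm2 n z)\<^sup>2)"

lemma norm2_L2_set: "norm2 n z = L2_set z {..<n}"
  by (simp add: norm2_def L2_set_def)

lemma norm2_nonneg [simp]: "0 \<le> norm2 n z"
  by (simp add: norm2_L2_set)

lemma norm2_power2: "(norm2 n z)\<^sup>2 = (\<Sum>i<n. (z i)\<^sup>2)"
  by (simp add: norm2_def sum_nonneg)

lemma norm2_triangle: "norm2 n (\<lambda>i. y i + z i) \<le> norm2 n y + norm2 n z"
  by (simp add: norm2_L2_set L2_set_triangle_ineq)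

lemma norm2_minus: "norm2 n (\<lambda>i. - z i) = norm2 n z"
  by (simp add: norm2_def)

lemma norm2_restr:
  assumes "S \<subseteq> {..<n}"
  shows "norm2 n (restr S z) = L2_set z S"
proof -
  have "(\<Sum>i<n. (restr S z i)\<^sup>2) = (\<Sum>i\<in>S. (z i)\<^sup>2)"
    using assms by (intro sum.mono_neutral_cong_right) (auto simp: restr_def)
  then show ?thesis
    by (simp add: norm2_def L2_set_def)
qed

lemma restr_Un:
  assumes "S \<inter> T = {}"
  shows "restr (S \<union> T) z = (\<lambda>i. restr S z i + restr T z i)"
  using assms by (intro ext) (auto simp: restr_def)

lemma restr_UN:
  assumes "finite J" "\<And>i j. i \<in> J \<Longrightarrow> j \<in> J \<Longrightarrow> i \<noteq> j \<Longrightarrow> S i \<inter> S j = {}"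
  shows "restr (\<Union>j\<in>J. S j) z = (\<lambda>i. \<Sum>j\<in>J. restr (S j) z i)"
  using assms
proof (induction J)
  case (insert j J)
  then have "S j \<inter> (\<Union>j\<in>J. S j) = {}"
    by blast
  then show ?case
    using insert by (simp add: restr_Un)
qed (simp add: restr_def)

lemma sparse_restr:
  assumes "card S \<le> s" "finite S"
  shows "sparse s n (restr S z)"
  unfolding sparse_def
  by (rule order_trans[OF card_mono[OF assms(2)] assms(1)]) (auto simp: restr_def split: if_splits)

lemma matvec_add: "matvec m n A (\<lambda>i. y i + z i) = (\<lambda>j. matvec m n A y j + matvec m n A z j)"
  by (auto simp: matvec_def algebra_simps sum.distrib)

lemma matvec_diff: "matvec m n A (\<lambda>i. y i - z i) = (\<lambda>j. matvec m n A y j - matvec m n A z j)"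
  by (auto simp: matvec_def algebra_simps sum_subtractf)

lemma matvec_scale: "matvec m n A (\<lambda>i. a * z i) = (\<lambda>j. a * matvec m n A z j)"
  by (auto simp: matvec_def sum_distrib_left algebra_simps)

lemma matvec_sum: "finite J \<Longrightarrow> matvec m n A (\<lambda>i. \<Sum>j\<in>J. f j i) = (\<lambda>r. \<Sum>j\<in>J. matvec m n A (f j) r)"
proof (induction J rule: finite_induct)
  case empty
  then show ?case by (auto simp: matvec_def)
qed (simp add: matvec_add)

text \<open>Cauchy-Schwarz bounds the operator by the squared Frobenius norm \<open>B\<close>, and
  \<open>B + 1\<close> makes the lower estimate trivial. An infimum over the empty set would carry
  no information.\<close>

lemma rip_set_nonempty: "\<exists>d. rip m n A s d"
proof -
  define B where "B = (\<Sum>j<m. \<Sum>i<n. (A j i)\<^sup>2)"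
  have "0 \<le> B"
    by (simp add: B_def sum_nonneg)
  have le: "(norm2 m (matvec m n A z))\<^sup>2 \<le> B * (norm2 n z)\<^sup>2" for z
  proof -
    have "(norm2 m (matvec m n A z))\<^sup>2 = (\<Sum>j<m. (\<Sum>i<n. A j i * z i)\<^sup>2)"
      by (simp add: norm2_power2 matvec_def)
    also have "\<dots> \<le> (\<Sum>j<m. (\<Sum>i<n. (A j i)\<^sup>2) * (\<Sum>i<n. (z i)\<^sup>2))"
      by (intro sum_mono Cauchy_Schwarz_ineq_sum)
    also have "\<dots> = B * (norm2 n z)\<^sup>2"
      by (simp add: B_def norm2_power2 sum_distrib_right)
    finally show ?thesis .
  qed
  have "rip m n A s (B + 1)"
    unfolding rip_def
  proof (intro allI impI conjI)
    fix z
    have "(1 - (B + 1)) * (norm2 n z)\<^sup>2 \<le> 0"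
      using \<open>0 \<le> B\<close> by (intro mult_nonpos_nonneg) auto
    then show "(1 - (B + 1)) * (norm2 n z)\<^sup>2 \<le> (norm2 m (matvec m n A z))\<^sup>2"
      by (rule order_trans) simp
    have "B * (norm2 n z)\<^sup>2 \<le> (1 + (B + 1)) * (norm2 n z)\<^sup>2"
      by (intro mult_right_mono) auto
    then show "(norm2 m (matvec m n A z))\<^sup>2 \<le> (1 + (B + 1)) * (norm2 n z)\<^sup>2"
      using le[of z] by linarith
  qed
  then show ?thesis ..
qed

text \<open>The infimum is attained: for each fixed \<open>z\<close> the condition is the closed
  inequality \<bar>q - r\<bar> \<le> d q, which survives passing to \<open>Inf\<close>.\<close>

lemma rip_rip_const:
  assumes "0 < s" "0 < n"
  shows "rip m n A s (rip_const m n A s)"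
proof -
  define D where "D = {d. rip m n A s d}"
  have eq: "rip_const m n A s = Inf D"
    by (simp add: rip_const_def D_def rip_def)
  have ne: "D \<noteq> {}"
    using rip_set_nonempty by (auto simp: D_def)
  \<comment> \<open>A unit vector that is \<open>s\<close>-sparse forces \<open>0 \<le> d\<close>,
    so the set is bounded below.\<close>
  define z0 where "z0 = restr {0} (\<lambda>_. 1)"
  have z0: "sparse s n z0" "norm2 n z0 = 1"
    using assms by (auto simp: z0_def norm2_restr L2_set_def intro!: sparse_restr)
  have lb: "0 \<le> d" if "d \<in> D" for d
  proof -
    have "(1 - d) * (norm2 n z0)\<^sup>2 \<le> (1 + d) * (norm2 n z0)\<^sup>2"
      using that z0(1) unfolding D_def rip_def by (blast intro: order_trans)
    then show ?thesis
      by (simp add: z0(2))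
  qed
  then have bdd: "bdd_below D"
    by (meson bdd_belowI)
  show ?thesis
    unfolding rip_def eq
  proof (intro allI impI)
    fix z assume z: "sparse s n z"
    let ?q = "(norm2 n z)\<^sup>2" and ?r = "(norm2 m (matvec m n A z))\<^sup>2"
    have *: "\<bar>?q - ?r\<bar> \<le> d * ?q" if "d \<in> D" for d
    proof -
      have "(1 - d) * ?q \<le> ?r" "?r \<le> (1 + d) * ?q"
        using that z unfolding D_def rip_def by blast+
      then show ?thesis
        by (simp add: abs_le_iff algebra_simps)
    qed
    have "\<bar>?q - ?r\<bar> \<le> Inf D * ?q"
    proof (cases "?q = 0")
      case True
      obtain d where "d \<in> D"
        using ne by blast
      then show ?thesis
        using *[of d] True by simp
    next
      case False
      then have q: "0 < ?q"
        by simp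
      have "\<bar>?q - ?r\<bar> / ?q \<le> Inf D"
        using ne * q by (intro cInf_greatest) (simp_all add: field_simps)
      then show ?thesis
        using q by (simp add: field_simps)
    qed
    then show "(1 - Inf D) * ?q \<le> ?r \<and> ?r \<le> (1 + Inf D) * ?q"
      by (auto simp: algebra_simps abs_le_iff)
  qed
qed

text \<open>The bound is optimised at \<open>t = b / a\<close>; if \<open>a\<close> or
  \<open>b\<close> vanishes, \<open>t\<close> is sent to infinity or to 0 instead.\<close>

lemma le_mult_of_scaled_amgm:
  fixes a b x :: real
  assumes "0 \<le> a" "0 \<le> b" "\<And>t. 0 < t \<Longrightarrow> 2 * x \<le> t * a\<^sup>2 + b\<^sup>2 / t"
  shows "x \<le> a * b"
proof (cases "a = 0 \<or> b = 0")
  case False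
  then have pos: "0 < a" "0 < b"
    using assms by auto
  then have "b / a * a\<^sup>2 + b\<^sup>2 / (b / a) = 2 * (a * b)"
    by (simp add: power2_eq_square)
  then show ?thesis
    using assms(3)[of "b / a"] pos by simp
next
  case True
  show ?thesis
  proof (rule ccontr)
    assume "\<not> ?thesis"
    with True have x: "0 < x"
      by auto
    \<comment> \<open>Concrete small and large parameters for the degenerate cases; each makes the
      right-hand side at most \<open>x\<close>, against \<open>2 * x\<close>. Adding 1 keeps them
      positive.\<close>
    define t where "t = x / (a\<^sup>2 + 1)"
    define u where "u = (b\<^sup>2 + 1) / x"
    have pos: "0 < a\<^sup>2 + 1" "0 < b\<^sup>2 + 1"
      by (simp_all add: add_nonneg_pos)
    show False
    proof (cases "b = 0")
      case True
      have "2 * x \<le> t * a\<^sup>2"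
        using assms(3)[of t] x pos True by (simp add: t_def)
      also have "\<dots> \<le> t * (a\<^sup>2 + 1)"
        using x pos by (intro mult_left_mono) (simp_all add: t_def)
      also have "\<dots> = x"
        using pos by (simp add: t_def)
      finally show False
        using x by simp
    next
      case False
      then have "a = 0"
        using True by simp
      then have "2 * x \<le> b\<^sup>2 / u"
        using assms(3)[of u] x pos by (simp add: u_def)
      also have "\<dots> \<le> x"
        using x pos by (simp add: u_def field_simps)
      finally show False
        using x by simp
    qed
  qed
qed

text \<open>Polarisation: the two-sided estimate for \<open>t\<close> times the first piece plus or
  minus the second, followed by optimisation over \<open>t\<close>. Disjointness gives both
  combinations the same norm.\<close>

lemma rip_inner:
  assumes rip: "rip m n A (2 * k) d" and d: "0 \<le> d"
    and S: "S \<subseteq> {..<n}" "card S \<le> k" and T: "T \<subseteq> {..<n}" "card T \<le> k" and disj: "S \<inter> T = {}"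
  shows "(\<Sum>r<m. matvec m n A (restr S z) r * matvec m n A (restr T z) r) \<le> d * (L2_set z S * L2_set z T)"
    (is "?ip \<le> _")
proof -
  have fin: "finite S" "finite T"
    using S T finite_subset by blast+
  have disj': "S \<inter> T = {}" "\<And>i. i \<in> S \<Longrightarrow> i \<notin> T"
    using disj by auto
  define f where "f a b = (\<lambda>i. a * restr S z i + b * restr T z i)" for a b
  have f_restr: "f a b = restr (S \<union> T) (\<lambda>i. if i \<in> S then a * z i else b * z i)" for a b
    using disj' by (auto simp: f_def restr_def)
  have sp: "sparse (2 * k) n (f a b)" for a b
    unfolding f_restr using S T fin by (intro sparse_restr) (auto intro: order_trans[OF card_Un_le])
  have nf: "(norm2 n (f a b))\<^sup>2 = a\<^sup>2 * (L2_set z S)\<^sup>2 + b\<^sup>2 * (L2_set z T)\<^sup>2" for a b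
  proof -
    have "(f a b i)\<^sup>2 = a\<^sup>2 * (restr S z i)\<^sup>2 + b\<^sup>2 * (restr T z i)\<^sup>2" for i
      using disj' by (auto simp: f_def restr_def power_mult_distrib)
    then have "(norm2 n (f a b))\<^sup>2 = a\<^sup>2 * (norm2 n (restr S z))\<^sup>2 + b\<^sup>2 * (norm2 n (restr T z))\<^sup>2"
      by (simp add: norm2_power2 sum.distrib sum_distrib_left)
    then show ?thesis
      using S T by (simp add: norm2_restr)
  qed
  define p q where "p = (norm2 m (matvec m n A (restr S z)))\<^sup>2" and "q = (norm2 m (matvec m n A (restr T z)))\<^sup>2"
  have Af: "(norm2 m (matvec m n A (f a b)))\<^sup>2 = a\<^sup>2 * p + b\<^sup>2 * q + 2 * a * b * ?ip" for a b
  proof -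
    have "(norm2 m (matvec m n A (f a b)))\<^sup>2 = (\<Sum>r<m. (a * matvec m n A (restr S z) r + b * matvec m n A (restr T z) r)\<^sup>2)"
      by (simp add: norm2_power2 f_def matvec_add matvec_scale)
    also have "\<dots> = (\<Sum>r<m. a\<^sup>2 * (matvec m n A (restr S z) r)\<^sup>2 + b\<^sup>2 * (matvec m n A (restr T z) r)\<^sup>2
        + 2 * a * b * (matvec m n A (restr S z) r * matvec m n A (restr T z) r))"
      by (intro sum.cong) (auto simp: power2_eq_square algebra_simps)
    finally show ?thesis
      by (simp add: p_def q_def norm2_power2 sum.distrib sum_distrib_left)
  qed
  have "2 * ?ip \<le> t * (sqrt d * L2_set z S)\<^sup>2 + (sqrt d * L2_set z T)\<^sup>2 / t" if t: "0 < t" for t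
  proof -
    have "(norm2 m (matvec m n A (f t 1)))\<^sup>2 \<le> (1 + d) * (norm2 n (f t 1))\<^sup>2"
      and "(1 - d) * (norm2 n (f t (-1)))\<^sup>2 \<le> (norm2 m (matvec m n A (f t (-1))))\<^sup>2"
      using rip sp by (auto simp: rip_def)
    \<comment> \<open>Adding the two estimates cancels \<open>p\<close> and \<open>q\<close> and
      leaves only the cross term.\<close>
    then have "4 * t * ?ip \<le> 2 * d * (t\<^sup>2 * (L2_set z S)\<^sup>2 + (L2_set z T)\<^sup>2)"
      unfolding nf Af by (simp add: algebra_simps)
    then have "2 * ?ip \<le> d * (t\<^sup>2 * (L2_set z S)\<^sup>2 + (L2_set z T)\<^sup>2) / t"
      using t by (subst pos_le_divide_eq) (simp_all add: algebra_simps)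
    also have "\<dots> = t * (d * (L2_set z S)\<^sup>2) + d * (L2_set z T)\<^sup>2 / t"
      using t by (simp add: add_divide_distrib distrib_left power2_eq_square)
    finally show ?thesis
      using d by (simp add: power_mult_distrib)
  qed
  then have "?ip \<le> (sqrt d * L2_set z S) * (sqrt d * L2_set z T)"
    using d by (intro le_mult_of_scaled_amgm) auto
  also have "\<dots> = (sqrt d * sqrt d) * (L2_set z S * L2_set z T)"
    by (simp add: algebra_simps)
  finally show ?thesis
    using d by simp
qed

text \<open>Expand the square of the sum: the diagonal uses the upper isometry bound, the rest
  \<open>rip_inner\<close>.\<close>

lemma rip_blocks:
  assumes rip: "rip m n A (2 * k) d" and d: "0 \<le> d" and J: "finite J"
    and S: "\<And>j. j \<in> J \<Longrightarrow> S j \<subseteq> {..<n}" "\<And>j. j \<in> J \<Longrightarrow> card (S j) \<le> k"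
    and disj: "\<And>i j. i \<in> J \<Longrightarrow> j \<in> J \<Longrightarrow> i \<noteq> j \<Longrightarrow> S i \<inter> S j = {}"
  shows "(norm2 m (matvec m n A (restr (\<Union>j\<in>J. S j) z)))\<^sup>2
    \<le> (\<Sum>j\<in>J. (L2_set z (S j))\<^sup>2) + d * (\<Sum>j\<in>J. L2_set z (S j))\<^sup>2"
proof -
  define u where "u j = matvec m n A (restr (S j) z)" for j
  define a where "a j = L2_set z (S j)" for j
  \<comment> \<open>The diagonal also carries \<open>d * (a i * a i)\<close>, so that the
    \<open>d\<close>-terms complete to the square of the sum.\<close>
  have ip: "(\<Sum>r<m. u i r * u j r) \<le> (if i = j then (a i)\<^sup>2 else 0) + d * (a i * a j)"
    if "i \<in> J" "j \<in> J" for i j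
  proof (cases "i = j")
    case True
    have "sparse (2 * k) n (restr (S i) z)"
      using S[OF that(1)] by (intro sparse_restr) (auto intro: finite_subset)
    then have "(norm2 m (u i))\<^sup>2 \<le> (1 + d) * (a i)\<^sup>2"
      using rip S(1)[OF that(1)] by (auto simp: rip_def u_def a_def norm2_restr)
    then show ?thesis
      unfolding norm2_power2 using True by (simp add: power2_eq_square algebra_simps)
  next
    case False
    then show ?thesis
      using rip_inner[OF rip d S[OF that(1)] S[OF that(2)] disj[OF that False]]
      by (simp add: u_def a_def)
  qed
  have "(norm2 m (matvec m n A (restr (\<Union>j\<in>J. S j) z)))\<^sup>2 = (\<Sum>r<m. (\<Sum>j\<in>J. u j r)\<^sup>2)"
    using J disj by (simp add: restr_UN matvec_sum norm2_power2 u_def)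
  also have "\<dots> = (\<Sum>r<m. \<Sum>i\<in>J. \<Sum>j\<in>J. u i r * u j r)"
    by (simp add: power2_eq_square sum_product)
  also have "\<dots> = (\<Sum>i\<in>J. \<Sum>j\<in>J. \<Sum>r<m. u i r * u j r)"
    by (subst sum.swap, rule sum.cong[OF refl], rule sum.swap)
  also have "\<dots> \<le> (\<Sum>i\<in>J. \<Sum>j\<in>J. (if i = j then (a i)\<^sup>2 else 0) + d * (a i * a j))"
    by (intro sum_mono ip)
  also have "\<dots> = (\<Sum>i\<in>J. (a i)\<^sup>2) + d * (\<Sum>i\<in>J. \<Sum>j\<in>J. a i * a j)"
    using J by (simp add: sum.distrib sum_distrib_left)
  also have "(\<Sum>i\<in>J. \<Sum>j\<in>J. a i * a j) = (\<Sum>j\<in>J. a j)\<^sup>2"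
    by (simp add: power2_eq_square sum_product)
  finally show ?thesis
    by (simp add: a_def)
qed

section \<open>Consecutive blocks and the estimates for a decreasing vector\<close>

lemma block_iff:
  fixes j k x :: nat
  assumes "0 < k"
  shows "x \<in> {j * k..<Suc j * k} \<longleftrightarrow> x div k = j"
proof -
  have "x \<in> {j * k..<Suc j * k} \<longleftrightarrow> j \<le> x div k \<and> x div k < Suc j"
    by (simp only: atLeastLessThan_iff less_eq_div_iff_mult_less_eq[OF assms] div_less_iff_less_mult[OF assms])
  then show ?thesis
    by auto
qed

lemma blocks_disjoint:
  fixes i j k :: nat
  assumes "0 < k" "i \<noteq> j"
  shows "{i * k..<Suc i * k} \<inter> {j * k..<Suc j * k} = {}"
  using assms(2) by (simp only: set_eq_iff Int_iff empty_iff block_iff[OF assms(1)]) simp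

lemma blocks_Union:
  fixes a b k :: nat
  assumes "0 < k"
  shows "(\<Union>j\<in>{a..<b}. {j * k..<Suc j * k}) = {a * k..<b * k}"
proof -
  have "(\<Union>j\<in>{a..<b}. {j * k..<Suc j * k}) = {x. a \<le> x div k \<and> x div k < b}"
    by (simp only: set_eq_iff UN_iff block_iff[OF assms] mem_Collect_eq) auto
  also have "\<dots> = {a * k..<b * k}"
    using assms by (auto simp: less_eq_div_iff_mult_less_eq div_less_iff_less_mult)
  finally show ?thesis .
qed

lemma matvec_restr: "matvec m n A (restr {..<n} z) = matvec m n A z"
  by (auto simp: matvec_def restr_def intro!: sum.cong)

lemma L2_set_power2: "(L2_set z S)\<^sup>2 = (\<Sum>i\<in>S. (z i)\<^sup>2)"
  by (simp add: L2_set_def sum_nonneg)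

text \<open>Only \<open>\<omega>\<^sup>2 \<le> 2 * W\<close> is available here, so the cross term
  grows by \<open>sqrt 2\<close>; enlarging the coefficient of \<alpha> to \<open>sqrt 2\<close>
  absorbs this and leaves that of \<open>sqrt W\<close> at 1.\<close>

lemma head_noise_bound:
  fixes \<alpha> \<omega> u v W :: real
  assumes "0 \<le> \<alpha>" "0 \<le> \<omega>" "u + v \<le> (\<alpha> + \<omega>)\<^sup>2" "\<omega>\<^sup>2 - v \<le> W" "\<omega>\<^sup>2 \<le> 2 * W"
  shows "sqrt u \<le> sqrt 2 * \<alpha> + sqrt W"
proof (rule real_le_lsqrt)
  have W: "0 \<le> W"
    using assms(5) zero_le_power2[of \<omega>] by linarith
  then show "0 \<le> sqrt 2 * \<alpha> + sqrt W"
    using assms(1) by simp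
  have "\<omega> \<le> sqrt (2 * W)"
    using assms(5) by (rule real_le_rsqrt)
  then have "\<alpha> * \<omega> \<le> \<alpha> * (sqrt 2 * sqrt W)"
    using assms(1) by (intro mult_left_mono) (simp_all add: real_sqrt_mult)
  moreover have "u \<le> \<alpha>\<^sup>2 + 2 * (\<alpha> * \<omega>) + W"
    using assms(3,4) by (simp add: power2_sum)
  moreover have "(sqrt 2 * \<alpha> + sqrt W)\<^sup>2 = 2 * \<alpha>\<^sup>2 + 2 * (\<alpha> * (sqrt 2 * sqrt W)) + W"
    using W by (simp add: power2_sum power_mult_distrib)
  moreover have "0 \<le> \<alpha>\<^sup>2"
    by simp
  ultimately show "u \<le> (sqrt 2 * \<alpha> + sqrt W)\<^sup>2"
    by linarith
qed

text \<open>Here \<open>v\<close> is added to the left side and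
  \<open>\<omega>\<^sup>2 \<le> W\<close> holds, so \<alpha> keeps coefficient 1.\<close>

lemma total_noise_bound:
  fixes \<alpha> \<omega> u v W :: real
  assumes "0 \<le> \<alpha>" "0 \<le> \<omega>" "u \<le> (\<alpha> + \<omega>)\<^sup>2" "\<omega>\<^sup>2 + v \<le> W" "0 \<le> v"
  shows "sqrt (u + v) \<le> \<alpha> + sqrt W"
proof (rule real_le_lsqrt)
  have W: "\<omega>\<^sup>2 \<le> W"
    using assms by linarith
  then have W0: "0 \<le> W"
    by (rule order_trans[rotated]) simp
  then show "0 \<le> \<alpha> + sqrt W"
    using assms(1) by simp
  have "\<alpha> * \<omega> \<le> \<alpha> * sqrt W"
    using assms(1) W by (intro mult_left_mono real_le_rsqrt)
  then show "u + v \<le> (\<alpha> + sqrt W)\<^sup>2"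
    using assms(3,4) W0 by (simp add: power2_sum)
qed

text \<open>In the proof, \<open>\<omega>\<close> is the norm of the image of all blocks behind the first two. The hypothesis
  \<open>\<omega>\<^sup>2 \<le> 2 W\<close> of \<open>head_noise_bound\<close> is the place where \<open>1/2 \<le> d\<close> is needed.\<close>

lemma rip_sorted_bounds:
  fixes h :: "nat \<Rightarrow> real"
  assumes p: "0 < p" "p < 1" and k: "0 < k" and l: "0 < l" and n: "n = (l + 1) * k"
    and rip: "rip m n A (2 * k) d" and d: "1 / 2 \<le> d" "d < 1"
    and dec: "\<And>i j. i \<le> j \<Longrightarrow> j < n \<Longrightarrow> \<bar>h j\<bar> \<le> \<bar>h i\<bar>"
  defines "M \<equiv> max (gfun p) (2 powr (1 - 2 / p))"
    and "N \<equiv> real k powr (1 - 2 / p) * (\<Sum>i=k..<n. \<bar>h i\<bar> powr p) powr (2 / p)"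
    and "\<alpha> \<equiv> norm2 m (matvec m n A h)"
  shows "sqrt ((1 - d) * (\<Sum>i<k. (h i)\<^sup>2))
      \<le> sqrt 2 * \<alpha> + sqrt (((2 - d) powr (1 - 2 / p) * gfun p + 2 * d * M) * N)"
    and "sqrt ((1 - d) * (norm2 n h)\<^sup>2) \<le> \<alpha> + sqrt (((2 - d) * gfun p + 2 * d * M) * N)"
proof -
  have kl: "k \<le> l * k"
    using l by simp
  then have kn: "2 * k \<le> n" "n = l * k + k"
    by (simp_all add: n)
  define U where "U = (\<Sum>i<k. (h i)\<^sup>2)"
  define V where "V = (\<Sum>i=k..<2 * k. (h i)\<^sup>2)"
  define S where "S = (\<Sum>i=2 * k..<n. (h i)\<^sup>2)"
  \<comment> \<open>Shifted by one block: block \<open>j\<close> of \<open>c\<close> is block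
    \<open>j + 1\<close> of \<open>h\<close>, and \<open>h\<^sub>1\<close> becomes the head of
    \<open>c\<close>.\<close>
  define c where "c i = \<bar>h (i + k)\<bar>" for i
  define L where "L = (\<Sum>j=1..<l. L2_set c {j * k..<Suc j * k})"
  define \<omega> where "\<omega> = norm2 m (matvec m n A (restr {2 * k..<n} h))"
  have c: "\<And>i. i < l * k \<Longrightarrow> 0 \<le> c i" "\<And>i j. i \<le> j \<Longrightarrow> j < l * k \<Longrightarrow> c j \<le> c i"
    using dec kn(2) by (auto simp: c_def)
  have shift: "(\<Sum>i=a + k..<b + k. f (h i)) = (\<Sum>i=a..<b. f (h (i + k)))" for a b and f :: "real \<Rightarrow> real"
    by (rule sum.shift_bounds_nat_ivl)
  have shiftp: "(\<Sum>i=k..<n. \<bar>h i\<bar> powr p) = (\<Sum>i<l * k. c i powr p)"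
    using shift[of "\<lambda>x. \<bar>x\<bar> powr p" 0 "l * k"] by (simp add: kn(2) c_def lessThan_atLeast0)
  have shiftS: "S = (\<Sum>i=k..<l * k. (c i)\<^sup>2)"
    using shift[of "\<lambda>x. x\<^sup>2" k "l * k"] by (simp add: kn(2) c_def S_def mult_2)
  have shiftV: "V = (\<Sum>i<k. (c i)\<^sup>2)"
    using shift[of "\<lambda>x. x\<^sup>2" 0 k] by (simp add: c_def V_def mult_2 lessThan_atLeast0)
  have N0: "0 \<le> N" and V0: "0 \<le> V" and S0: "0 \<le> S" and U0: "0 \<le> U"
    by (simp_all add: N_def V_def S_def U_def sum_nonneg)
  have M: "gfun p \<le> M" "0 \<le> M" and g: "0 \<le> gfun p"
    using gfun_pos[of p] p by (auto simp: M_def le_max_iff_disj)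
  have NZ: "N = real k powr (1 - 2 / p) * (\<Sum>i<l * k. c i powr p) powr (2 / p)"
    by (simp add: N_def shiftp)
  have tail1: "S \<le> gfun p * N"
    using stechkin[of p 1 k "l * k" c] p k kl c by (simp add: NZ shiftS mult.assoc)
  \<comment> \<open>The weight \<open>a = 2 - d\<close> is chosen so that \<open>a - 1\<close> is
    the factor \<open>1 - d\<close> of \<open>V\<close> in the lower isometry bound.\<close>
  have tail2: "S - (1 - d) * V \<le> (2 - d) powr (1 - 2 / p) * gfun p * N"
    using stechkin[of p "2 - d" k "l * k" c] p k kl c d by (simp add: NZ shiftS shiftV mult.assoc)
  have tail3: "L\<^sup>2 \<le> 2 * M * N"
    unfolding L_def M_def NZ by (rule block_norm_sum) (use p k c in auto)
  have blk: "L2_set h {Suc j * k..<Suc (Suc j) * k} = L2_set c {j * k..<Suc j * k}" for j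
    using shift[of "\<lambda>x. x\<^sup>2" "j * k" "Suc j * k"] by (simp add: L2_set_def c_def add_ac)
  have sumL: "(\<Sum>j=2..<Suc l. L2_set h {j * k..<Suc j * k}) = L"
    unfolding L_def numeral_2_eq_2 sum.shift_bounds_Suc_ivl blk by simp
  have W: "(\<Union>j\<in>{2..<Suc l}. {j * k..<Suc j * k}) = {2 * k..<n}"
    using blocks_Union[OF k] by (simp add: n)
  have sumS: "(\<Sum>j=2..<Suc l. (L2_set h {j * k..<Suc j * k})\<^sup>2) = S"
    unfolding L2_set_power2 S_def W[symmetric]
    using blocks_disjoint[OF k] by (intro sum.UNION_disjoint[symmetric]) auto
  have "\<omega>\<^sup>2 \<le> (\<Sum>j=2..<Suc l. (L2_set h {j * k..<Suc j * k})\<^sup>2)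
      + d * (\<Sum>j=2..<Suc l. L2_set h {j * k..<Suc j * k})\<^sup>2"
    unfolding \<omega>_def W[symmetric]
  proof (rule rip_blocks[OF rip])
    show "{j * k..<Suc j * k} \<subseteq> {..<n}" if "j \<in> {2..<Suc l}" for j
    proof -
      have "{j * k..<Suc j * k} \<subseteq> {2 * k..<n}"
        unfolding W[symmetric] using that by blast
      then show ?thesis
        by auto
    qed
  qed (use d blocks_disjoint[OF k] in auto)
  then have \<omega>: "\<omega>\<^sup>2 \<le> S + d * L\<^sup>2"
    by (simp only: sumS sumL)
  have dL: "d * L\<^sup>2 \<le> 2 * d * (M * N)"
    using mult_left_mono[OF tail3, of d] d by (simp add: algebra_simps)
  \<comment> \<open>The first two blocks form a \<open>2 * k\<close>-sparse vector whose image is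
    that of \<open>h\<close> minus that of the tail.\<close>
  have "{..<n} = {..<2 * k} \<union> {2 * k..<n}"
    using kn(1) by auto
  then have "restr {..<n} h = restr ({..<2 * k} \<union> {2 * k..<n}) h"
    by (rule arg_cong)
  also have "\<dots> = (\<lambda>i. restr {..<2 * k} h i + restr {2 * k..<n} h i)"
    by (rule restr_Un) auto
  finally have "matvec m n A (restr {..<n} h)
      = (\<lambda>j. matvec m n A (restr {..<2 * k} h) j + matvec m n A (restr {2 * k..<n} h) j)"
    by (simp only: matvec_add)
  then have "matvec m n A (restr {..<2 * k} h) = (\<lambda>j. matvec m n A h j + - matvec m n A (restr {2 * k..<n} h) j)"
    unfolding matvec_restr by simp
  then have tri: "norm2 m (matvec m n A (restr {..<2 * k} h)) \<le> \<alpha> + \<omega>"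
    unfolding \<alpha>_def \<omega>_def
    using norm2_triangle[of m "matvec m n A h" "\<lambda>j. - matvec m n A (restr {2 * k..<n} h) j"]
    by (simp only: norm2_minus)
  have UV: "U + V = (\<Sum>i<2 * k. (h i)\<^sup>2)"
    unfolding U_def V_def lessThan_atLeast0 by (rule sum.atLeastLessThan_concat) auto
  have "(norm2 n (restr {..<2 * k} h))\<^sup>2 = U + V"
    using kn(1) by (subst norm2_restr) (auto simp: L2_set_power2 UV)
  then have "(1 - d) * (U + V) \<le> (norm2 m (matvec m n A (restr {..<2 * k} h)))\<^sup>2"
    using rip sparse_restr[of "{..<2 * k}" "2 * k" n h] by (metis rip_def card_lessThan finite_lessThan order_refl)
  also have "\<dots> \<le> (\<alpha> + \<omega>)\<^sup>2"
    using tri by (intro power_mono) auto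
  finally have head: "(1 - d) * (U + V) \<le> (\<alpha> + \<omega>)\<^sup>2" .
  have \<alpha>\<omega>: "0 \<le> \<alpha>" "0 \<le> \<omega>"
    by (simp_all add: \<alpha>_def \<omega>_def)
  show "sqrt ((1 - d) * (\<Sum>i<k. (h i)\<^sup>2))
      \<le> sqrt 2 * \<alpha> + sqrt (((2 - d) powr (1 - 2 / p) * gfun p + 2 * d * M) * N)"
    unfolding U_def[symmetric]
  proof (rule head_noise_bound[OF \<alpha>\<omega>, of _ "(1 - d) * V"])
    show "(1 - d) * U + (1 - d) * V \<le> (\<alpha> + \<omega>)\<^sup>2"
      using head by (simp add: algebra_simps)
    show "\<omega>\<^sup>2 - (1 - d) * V \<le> ((2 - d) powr (1 - 2 / p) * gfun p + 2 * d * M) * N"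
      using \<omega> dL tail2 by (simp add: algebra_simps)
    \<comment> \<open>The energy term is at most \<open>M * N \<le> 2 * d * M * N\<close>, as large
      as the interaction term; hence the factor 2.\<close>
    have "gfun p * N \<le> M * N"
      using M N0 by (intro mult_right_mono)
    moreover have "1 * (M * N) \<le> (2 * d) * (M * N)"
      using M N0 d by (intro mult_right_mono) auto
    ultimately have "\<omega>\<^sup>2 \<le> 2 * (2 * d * (M * N))"
      using \<omega> dL tail1 by linarith
    moreover have "0 \<le> (2 - d) powr (1 - 2 / p) * gfun p * N"
      using g N0 by simp
    ultimately show "\<omega>\<^sup>2 \<le> 2 * (((2 - d) powr (1 - 2 / p) * gfun p + 2 * d * M) * N)"
      by (simp add: algebra_simps)
  qed
  have "(norm2 n h)\<^sup>2 = (U + V) + S"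
    unfolding norm2_power2 UV S_def lessThan_atLeast0
    using kn(1) by (intro sum.atLeastLessThan_concat[symmetric]) auto
  moreover have "sqrt ((1 - d) * (U + V) + (1 - d) * S) \<le> \<alpha> + sqrt (((2 - d) * gfun p + 2 * d * M) * N)"
  proof (rule total_noise_bound[OF \<alpha>\<omega> head])
    \<comment> \<open>One \<open>S\<close> comes from the tail image and \<open>1 - d\<close> copies
      from the energy being bounded.\<close>
    have "(2 - d) * S \<le> (2 - d) * (gfun p * N)"
      using tail1 d by (intro mult_left_mono) auto
    then show "\<omega>\<^sup>2 + (1 - d) * S \<le> ((2 - d) * gfun p + 2 * d * M) * N"
      using \<omega> dL by (simp add: algebra_simps)
  qed (use S0 d in auto)
  ultimately show "sqrt ((1 - d) * (norm2 n h)\<^sup>2) \<le> \<alpha> + sqrt (((2 - d) * gfun p + 2 * d * M) * N)"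
    by (simp add: algebra_simps)
qed

section \<open>From decreasing vectors to arbitrary ones\<close>

lemma sorting_permutation:
  fixes f :: "nat \<Rightarrow> real"
  obtains \<pi> where "\<pi> permutes {..<n}" "\<And>i j. i \<le> j \<Longrightarrow> j < n \<Longrightarrow> f (\<pi> j) \<le> f (\<pi> i)"
proof
  define xs where "xs = sort_key (\<lambda>i. - f i) [0..<n]"
  define \<pi> where "\<pi> i = (if i < n then xs ! i else i)" for i
  have xs: "length xs = n" "distinct xs" "set xs = {..<n}"
    by (auto simp: xs_def)
  have "bij_betw ((!) xs) {..<n} {..<n}"
    using xs by (intro bij_betw_nth) auto
  then have "bij_betw \<pi> {..<n} {..<n}"
    by (subst bij_betw_cong[of _ _ "(!) xs"]) (auto simp: \<pi>_def)
  then show "\<pi> permutes {..<n}"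
    by (rule bij_imp_permutes) (auto simp: \<pi>_def)
  have "sorted (map (\<lambda>i. - f i) xs)"
    by (simp add: xs_def)
  then show "f (\<pi> j) \<le> f (\<pi> i)" if "i \<le> j" "j < n" for i j
    using that xs(1) sorted_nth_mono[of "map (\<lambda>i. - f i) xs" i j] by (simp add: \<pi>_def)
qed

text \<open>Exchange argument: the indices of \<open>S\<close> outside the initial segment are no
  more numerous than those it misses, and \<open>c (k - 1)\<close> separates their values.\<close>

lemma sum_le_sum_initial:
  fixes c :: "nat \<Rightarrow> real"
  assumes nonneg: "\<And>i. i < n \<Longrightarrow> 0 \<le> c i"
    and dec: "\<And>i j. i \<le> j \<Longrightarrow> j < n \<Longrightarrow> c j \<le> c i"
    and S: "S \<subseteq> {..<n}" "card S \<le> k" and k: "0 < k" "k \<le> n"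
  shows "sum c S \<le> sum c {..<k}"
proof -
  have fin: "finite S"
    using S finite_subset by blast
  have t: "0 \<le> c (k - 1)"
    using nonneg k by simp
  have "card (S \<inter> {..<k}) + card (S - {..<k}) = card S" "card (S \<inter> {..<k}) + card ({..<k} - S) = k"
    using card_Int_Diff[of S "{..<k}"] card_Int_Diff[of "{..<k}" S] fin by (auto simp: Int_commute)
  then have card: "card (S - {..<k}) \<le> card ({..<k} - S)"
    using S by linarith
  have "sum c (S - {..<k}) \<le> card (S - {..<k}) * c (k - 1)"
    using S by (intro sum_bounded_above dec) auto
  also have "\<dots> \<le> card ({..<k} - S) * c (k - 1)"
    using card t by (intro mult_right_mono) auto
  also have "\<dots> \<le> sum c ({..<k} - S)"
    using k by (intro sum_bounded_below dec) auto
  finally show ?thesis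
    using sum.Int_Diff[of S c "{..<k}"] sum.Int_Diff[of "{..<k}" c S] fin by (simp add: Int_commute)
qed

text \<open>Permuting the columns of \<open>A\<close> together with \<open>h\<close> changes neither
  the image nor the norms nor sparsity. \<open>K\<close> holds positions of \<open>k\<close> largest
  entries; its maximality is used for the cone condition.\<close>

lemma rip_bounds:
  fixes h :: "nat \<Rightarrow> real"
  assumes p: "0 < p" "p < 1" and k: "0 < k" and l: "0 < l" and n: "n = (l + 1) * k"
    and rip: "rip m n A (2 * k) d" and d: "1 / 2 \<le> d" "d < 1"
  defines "M \<equiv> max (gfun p) (2 powr (1 - 2 / p))"
    and "\<alpha> \<equiv> norm2 m (matvec m n A h)"
  obtains K where "K \<subseteq> {..<n}" "card K = k"
    "\<And>S. S \<subseteq> {..<n} \<Longrightarrow> card S \<le> k \<Longrightarrow> (\<Sum>i\<in>S. \<bar>h i\<bar> powr p) \<le> (\<Sum>i\<in>K. \<bar>h i\<bar> powr p)"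
    "sqrt ((1 - d) * (\<Sum>i\<in>K. (h i)\<^sup>2)) \<le> sqrt 2 * \<alpha> + sqrt (((2 - d) powr (1 - 2 / p) * gfun p + 2 * d * M)
      * (real k powr (1 - 2 / p) * (\<Sum>i\<in>{..<n} - K. \<bar>h i\<bar> powr p) powr (2 / p)))"
    "sqrt ((1 - d) * (norm2 n h)\<^sup>2) \<le> \<alpha> + sqrt (((2 - d) * gfun p + 2 * d * M)
      * (real k powr (1 - 2 / p) * (\<Sum>i\<in>{..<n} - K. \<bar>h i\<bar> powr p) powr (2 / p)))"
proof -
  obtain \<pi> where \<pi>: "\<pi> permutes {..<n}" "\<And>i j. i \<le> j \<Longrightarrow> j < n \<Longrightarrow> \<bar>h (\<pi> j)\<bar> \<le> \<bar>h (\<pi> i)\<bar>"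
    using sorting_permutation[where f = "\<lambda>i. \<bar>h i\<bar>"] by blast
  have inj: "inj_on \<pi> S" for S
    using permutes_inj[OF \<pi>(1)] inj_on_subset by blast
  have kn: "k \<le> n"
    by (simp add: n)
  define A' where "A' j i = A j (\<pi> i)" for j i
  have perm: "(\<Sum>i<n. f (\<pi> i)) = (\<Sum>i<n. f i)" for f :: "nat \<Rightarrow> real"
    using sum.permute[OF \<pi>(1), of f] by (simp add: o_def)
  have norm: "norm2 n (\<lambda>i. z (\<pi> i)) = norm2 n z" for z
    using perm[of "\<lambda>i. (z i)\<^sup>2"] by (simp add: norm2_def)
  have mv: "matvec m n A' (\<lambda>i. z (\<pi> i)) = matvec m n A z" for z
    using perm[of "\<lambda>i. A j i * z i" for j] by (auto simp: matvec_def A'_def)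
  have sp: "sparse s n z" if "sparse s n (\<lambda>i. z (\<pi> i))" for s z
  proof -
    have "{i \<in> {..<n}. z i \<noteq> 0} = \<pi> ` {i \<in> {..<n}. z (\<pi> i) \<noteq> 0}"
      using permutes_image[OF \<pi>(1)] by auto
    then show ?thesis
      using that by (simp add: sparse_def card_image[OF inj])
  qed
  have rip': "rip m n A' (2 * k) d"
    unfolding rip_def
  proof (intro allI impI)
    fix z assume z: "sparse (2 * k) n z"
    \<comment> \<open>Every vector is a permuted one, so the isometry property of \<open>A\<close>
      transfers to \<open>A'\<close>.\<close>
    define y where "y i = z (inv \<pi> i)" for i
    have zy: "z = (\<lambda>i. y (\<pi> i))"
      using permutes_inverses[OF \<pi>(1)] by (simp add: y_def)
    show "(1 - d) * (norm2 n z)\<^sup>2 \<le> (norm2 m (matvec m n A' z))\<^sup>2 \<and>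
        (norm2 m (matvec m n A' z))\<^sup>2 \<le> (1 + d) * (norm2 n z)\<^sup>2"
      using rip sp[of "2 * k" y] z unfolding zy norm mv rip_def by blast
  qed
  define K where "K = \<pi> ` {..<k}"
  have im: "\<pi> ` {..<n} = {..<n}"
    by (rule permutes_image[OF \<pi>(1)])
  have K: "K \<subseteq> {..<n}" "card K = k"
    using im kn by (auto simp: K_def card_image[OF inj])
  have "{..<n} - K = \<pi> ` ({..<n} - {..<k})"
    unfolding K_def by (subst im[symmetric]) (rule image_set_diff[OF permutes_inj[OF \<pi>(1)], symmetric])
  moreover have "{..<n} - {..<k} = {k..<n}"
    by auto
  ultimately have tail: "(\<Sum>i=k..<n. f (\<pi> i)) = (\<Sum>i\<in>{..<n} - K. f i)" for f :: "nat \<Rightarrow> real"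
    by (simp add: sum.reindex[OF inj])
  have head: "(\<Sum>i<k. f (\<pi> i)) = (\<Sum>i\<in>K. f i)" for f :: "nat \<Rightarrow> real"
    by (simp add: K_def sum.reindex[OF inj])
  have top: "(\<Sum>i\<in>S. \<bar>h i\<bar> powr p) \<le> (\<Sum>i\<in>K. \<bar>h i\<bar> powr p)" if S: "S \<subseteq> {..<n}" "card S \<le> k" for S
  proof -
    obtain T where T: "T \<subseteq> {..<n}" "S = \<pi> ` T"
      using S(1) im by (metis subset_image_iff)
    then have "card T \<le> k"
      using S(2) card_image[OF inj] by simp
    then have "(\<Sum>i\<in>T. \<bar>h (\<pi> i)\<bar> powr p) \<le> (\<Sum>i<k. \<bar>h (\<pi> i)\<bar> powr p)"
      using T \<pi>(2) k kn p by (intro sum_le_sum_initial[of n]) (auto intro!: powr_mono2)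
    then show ?thesis
      using head[of "\<lambda>i. \<bar>h i\<bar> powr p"] by (simp add: T sum.reindex[OF inj])
  qed
  note bounds = rip_sorted_bounds[OF p k l n rip' d, of "\<lambda>i. h (\<pi> i)", OF \<pi>(2),
      unfolded norm mv head[of "\<lambda>i. (h i)\<^sup>2"] tail[of "\<lambda>i. \<bar>h i\<bar> powr p"], folded M_def \<alpha>_def]
  show thesis
    by (rule that[OF K top bounds])
qed

section \<open>Recovery\<close>

text \<open>After division by \<open>a + b\<close> both parts lie in the unit interval, where a
  number is at most its p-th power.\<close>

lemma powr_add_le:
  fixes a b p :: real
  assumes "0 \<le> a" "0 \<le> b" "0 \<le> p" "p \<le> 1"
  shows "(a + b) powr p \<le> a powr p + b powr p"
proof (cases "a + b = 0")
  case False
  then have pos: "0 < a + b"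
    using assms by simp
  have part: "c / (a + b) * (a + b) powr p \<le> c powr p" if "0 \<le> c" "c \<le> a + b" for c
  proof -
    have "(c / (a + b)) powr 1 \<le> (c / (a + b)) powr p"
      using that pos assms by (intro powr_mono') auto
    then have "c / (a + b) \<le> c powr p / (a + b) powr p"
      using that pos by (simp add: powr_divide)
    then show ?thesis
      using pos by (simp add: field_simps)
  qed
  have "a / (a + b) + b / (a + b) = 1"
    using pos by (simp flip: add_divide_distrib)
  then have "(a + b) powr p = a / (a + b) * (a + b) powr p + b / (a + b) * (a + b) powr p"
    by (metis distrib_right mult_1)
  also have "\<dots> \<le> a powr p + b powr p"
    using assms by (intro add_mono part) auto
  finally show ?thesis .
qed (use assms in auto)

lemma powr_abs_diff_ge:
  fixes a b p :: real
  assumes "0 \<le> p" "p \<le> 1"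
  shows "\<bar>a\<bar> powr p - \<bar>b\<bar> powr p \<le> \<bar>a - b\<bar> powr p"
proof -
  have "\<bar>a\<bar> powr p \<le> (\<bar>a - b\<bar> + \<bar>b\<bar>) powr p"
    using assms by (intro powr_mono2) auto
  also have "\<dots> \<le> \<bar>a - b\<bar> powr p + \<bar>b\<bar> powr p"
    using assms by (intro powr_add_le) auto
  finally show ?thesis
    by simp
qed

text \<open>Apply the reverse triangle inequality for p-th powers with \<open>x\<close> leading on
  \<open>S\<close> and \<open>h\<close> leading off \<open>S\<close>. The part of \<open>x\<close>
  off \<open>S\<close> then occurs on both sides of \<open>min\<close>, hence the factor 2.\<close>

lemma cone_condition:
  fixes x h :: "nat \<Rightarrow> real"
  assumes p: "0 < p" "p \<le> 1" and S: "S \<subseteq> {..<n}"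
    and min: "(\<Sum>i<n. \<bar>x i - h i\<bar> powr p) \<le> (\<Sum>i<n. \<bar>x i\<bar> powr p)"
  shows "(\<Sum>i\<in>{..<n} - S. \<bar>h i\<bar> powr p)
    \<le> (\<Sum>i\<in>S. \<bar>h i\<bar> powr p) + 2 * (\<Sum>i\<in>{..<n} - S. \<bar>x i\<bar> powr p)"
proof -
  have split: "(\<Sum>i<n. f i) = (\<Sum>i\<in>{..<n} - S. f i) + (\<Sum>i\<in>S. f i)" for f :: "nat \<Rightarrow> real"
    using S by (intro sum.subset_diff) auto
  have "(\<Sum>i\<in>S. \<bar>x i\<bar> powr p - \<bar>h i\<bar> powr p) \<le> (\<Sum>i\<in>S. \<bar>x i - h i\<bar> powr p)"
    using p by (intro sum_mono powr_abs_diff_ge) auto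
  moreover have "(\<Sum>i\<in>{..<n} - S. \<bar>h i\<bar> powr p - \<bar>x i\<bar> powr p) \<le> (\<Sum>i\<in>{..<n} - S. \<bar>x i - h i\<bar> powr p)"
    using p powr_abs_diff_ge[of p "h i" "x i" for i] by (intro sum_mono) (auto simp: abs_minus_commute)
  ultimately show ?thesis
    using min by (simp add: split sum_subtractf)
qed

text \<open>Power mean inequality: Jensen for the exponent \<open>2 / p\<close> with equal
  weights.\<close>

lemma sum_powr_le_L2:
  fixes h :: "'a \<Rightarrow> real"
  assumes p: "0 < p" "p \<le> 2" and K: "finite K" "0 < card K"
  shows "(\<Sum>i\<in>K. \<bar>h i\<bar> powr p) \<le> real (card K) powr (1 - p / 2) * (\<Sum>i\<in>K. (h i)\<^sup>2) powr (p / 2)"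
proof -
  define k where "k = real (card K)"
  define P where "P = (\<Sum>i\<in>K. \<bar>h i\<bar> powr p)"
  have k: "0 < k"
    using K by (simp add: k_def)
  have P0: "0 \<le> P"
    by (simp add: P_def sum_nonneg)
  have "(P / k) powr (2 / p) = (\<Sum>i\<in>K. (1 / k) *\<^sub>R \<bar>h i\<bar> powr p) powr (2 / p)"
    by (simp add: P_def sum_divide_distrib)
  also have "\<dots> \<le> (\<Sum>i\<in>K. (1 / k) * (\<bar>h i\<bar> powr p) powr (2 / p))"
    using K p k by (intro convex_on_sum[OF _ _ convex_on_powr_nonneg]) (auto simp: k_def)
  also have "\<dots> = (\<Sum>i\<in>K. (h i)\<^sup>2) / k"
    using p by (simp add: powr_powr sum_divide_distrib)
  finally have "((P / k) powr (2 / p)) powr (p / 2) \<le> ((\<Sum>i\<in>K. (h i)\<^sup>2) / k) powr (p / 2)"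
    using p by (intro powr_mono2) auto
  then have "P / k \<le> (\<Sum>i\<in>K. (h i)\<^sup>2) powr (p / 2) / k powr (p / 2)"
    using p P0 k by (simp add: powr_powr powr_divide sum_nonneg)
  then have "P \<le> k * ((\<Sum>i\<in>K. (h i)\<^sup>2) powr (p / 2) / k powr (p / 2))"
    using k by (simp add: field_simps)
  then show ?thesis
    using k by (simp add: P_def k_def powr_diff)
qed

text \<open>Subadditivity of the p-th power separates noise from signal. It is used with
  \<open>s = 2\<close> for the head and \<open>s = 1\<close> for the whole vector.\<close>

lemma powr_of_noise_bound:
  fixes p d U W \<alpha> s c Q :: real
  assumes p: "0 < p" "p < 1" and d: "d < 1" and U: "0 \<le> U" and \<alpha>: "0 \<le> \<alpha>" "\<alpha> \<le> 2 * \<epsilon>"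
    and s: "0 \<le> s" and c: "0 \<le> c" and k: "0 < k" and Q: "0 \<le> Q"
    and bound: "sqrt ((1 - d) * U) \<le> sqrt s * \<alpha> + sqrt (c * (k powr (1 - 2 / p) * Q powr (2 / p)))"
  shows "U powr (p / 2) \<le> (c / (1 - d)) powr (p / 2) * k powr (p / 2 - 1) * Q
    + s powr (p / 2) * 2 powr p * \<epsilon> powr p / (1 - d) powr (p / 2)"
proof -
  have half: "sqrt y powr p = y powr (p / 2)" if "0 \<le> y" for y
    using that by (simp add: powr_half_sqrt[symmetric] powr_powr)
  have "((1 - d) * U) powr (p / 2) = sqrt ((1 - d) * U) powr p"
    using d U by (simp add: half)
  also have "\<dots> \<le> (sqrt s * \<alpha> + sqrt (c * (k powr (1 - 2 / p) * Q powr (2 / p)))) powr p"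
    using bound p d U by (intro powr_mono2) auto
  also have "\<dots> \<le> (sqrt s * \<alpha>) powr p + sqrt (c * (k powr (1 - 2 / p) * Q powr (2 / p))) powr p"
    using p s \<alpha> c by (intro powr_add_le) auto
  also have "(sqrt s * \<alpha>) powr p \<le> (sqrt s * (2 * \<epsilon>)) powr p"
    using p s \<alpha> by (intro powr_mono2 mult_left_mono) auto
  also have "\<dots> = s powr (p / 2) * 2 powr p * \<epsilon> powr p"
    using s \<alpha> by (simp add: powr_mult half)
  also have "sqrt (c * (k powr (1 - 2 / p) * Q powr (2 / p))) powr p = c powr (p / 2) * (k powr (p / 2 - 1) * Q)"
  proof -
    have "(1 - 2 / p) * (p / 2) = p / 2 - 1" "2 / p * (p / 2) = 1"
      using p by (simp_all add: field_simps)
    then have "(k powr (1 - 2 / p)) powr (p / 2) = k powr (p / 2 - 1)" "(Q powr (2 / p)) powr (p / 2) = Q"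
      using Q by (simp_all only: powr_powr) simp
    then show ?thesis
      using c Q by (simp add: half powr_mult)
  qed
  finally have "(1 - d) powr (p / 2) * U powr (p / 2)
      \<le> s powr (p / 2) * 2 powr p * \<epsilon> powr p + c powr (p / 2) * (k powr (p / 2 - 1) * Q)"
    using d U by (simp add: powr_mult)
  then show ?thesis
    using d c by (simp add: powr_divide field_simps)
qed

text \<open>The branches differ only in which term attains the maximum, as
  \<open>2 powr (2 - 2 / p)\<close> is twice \<open>2 powr (1 - 2 / p)\<close>.\<close>

lemma Cfun_eq:
  assumes "0 < p" "p < 1"
  shows "Cfun d p = (((2 - d) powr (1 - 2 / p) * gfun p + 2 * d * max (gfun p) (2 powr (1 - 2 / p))) / (1 - d)) powr (p / 2)"
  unfolding Cfun_def gfun_pstar[OF assms] by (simp add: powr_diff algebra_simps)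

lemma Dfun_eq:
  assumes "0 < p" "p < 1"
  shows "Dfun d p = (((2 - d) * gfun p + 2 * d * max (gfun p) (2 powr (1 - 2 / p))) / (1 - d)) powr (p / 2)"
  unfolding Dfun_def gfun_pstar[OF assms] by (simp add: powr_diff algebra_simps)

text \<open>\<open>S\<close> is arbitrary so that it can be the first \<open>k\<close> indices for
  the error bound and the support of \<open>x\<close> for exact recovery.\<close>

lemma recovery_bound:
  fixes x h :: "nat \<Rightarrow> real"
  assumes p: "0 < p" "p < 1" and k: "0 < k" and l: "0 < l" and n: "n = (l + 1) * k"
    and rip: "rip m n A (2 * k) d" and d: "1 / 2 \<le> d" "d < 1" and C: "Cfun d p < 1"
    and noise: "norm2 m (matvec m n A h) \<le> 2 * \<epsilon>"
    and min: "(\<Sum>i<n. \<bar>x i - h i\<bar> powr p) \<le> (\<Sum>i<n. \<bar>x i\<bar> powr p)"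
    and S: "S \<subseteq> {..<n}" "card S \<le> k"
  shows "norm2 n h powr p
    \<le> 2 * Dfun d p / (1 - Cfun d p) * real k powr (p / 2 - 1) * (\<Sum>i\<in>{..<n} - S. \<bar>x i\<bar> powr p)
      + 1 / (1 - d) powr (p / 2) * (2 powr p + 2 powr (3 * p / 2) * Dfun d p / (1 - Cfun d p)) * \<epsilon> powr p"
proof -
  obtain K where K: "K \<subseteq> {..<n}" "card K = k"
    and top: "\<And>S. S \<subseteq> {..<n} \<Longrightarrow> card S \<le> k \<Longrightarrow> (\<Sum>i\<in>S. \<bar>h i\<bar> powr p) \<le> (\<Sum>i\<in>K. \<bar>h i\<bar> powr p)"
    and b1: "sqrt ((1 - d) * (\<Sum>i\<in>K. (h i)\<^sup>2)) \<le> sqrt 2 * norm2 m (matvec m n A h)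
      + sqrt (((2 - d) powr (1 - 2 / p) * gfun p + 2 * d * max (gfun p) (2 powr (1 - 2 / p)))
      * (real k powr (1 - 2 / p) * (\<Sum>i\<in>{..<n} - K. \<bar>h i\<bar> powr p) powr (2 / p)))"
    and b2: "sqrt ((1 - d) * (norm2 n h)\<^sup>2) \<le> norm2 m (matvec m n A h)
      + sqrt (((2 - d) * gfun p + 2 * d * max (gfun p) (2 powr (1 - 2 / p)))
      * (real k powr (1 - 2 / p) * (\<Sum>i\<in>{..<n} - K. \<bar>h i\<bar> powr p) powr (2 / p)))"
    by (rule rip_bounds[OF p k l n rip d, of h]) (rule that)
  define P where "P = (\<Sum>i\<in>K. \<bar>h i\<bar> powr p)"
  define Q where "Q = (\<Sum>i\<in>{..<n} - K. \<bar>h i\<bar> powr p)"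
  define X where "X = (\<Sum>i\<in>{..<n} - S. \<bar>x i\<bar> powr p)"
  define E where "E = 2 powr (3 * p / 2) * \<epsilon> powr p / (1 - d) powr (p / 2)"
  define a where "a = real k powr (p / 2 - 1)"
  have Q0: "0 \<le> Q"
    by (simp add: Q_def sum_nonneg)
  have g: "0 \<le> gfun p" "0 \<le> max (gfun p) (2 powr (1 - 2 / p))"
    using gfun_pos[of p] p by (auto simp: le_max_iff_disj)
  have split: "(\<Sum>i<n. \<bar>h i\<bar> powr p) = (\<Sum>i\<in>{..<n} - R. \<bar>h i\<bar> powr p) + (\<Sum>i\<in>R. \<bar>h i\<bar> powr p)"
    if "R \<subseteq> {..<n}" for R
    using that by (intro sum.subset_diff) auto
  have a: "0 < a" "real k powr (1 - p / 2) * a = 1"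
    using k by (simp_all add: a_def flip: powr_add)
  \<comment> \<open>Replacing \<open>S\<close> by \<open>K\<close> only helps: the total is fixed
    and \<open>K\<close> carries at least the p-sum of \<open>S\<close>.\<close>
  have cone: "Q \<le> P + 2 * X"
    using cone_condition[OF p(1) less_imp_le[OF p(2)] S(1) min] top[OF S] split[OF S(1)] split[OF K(1)]
    unfolding P_def Q_def X_def by linarith
  have exps: "(2::real) powr (p / 2) * 2 powr p = 2 powr (3 * p / 2)"
    by (simp flip: powr_add)
  have U: "(\<Sum>i\<in>K. (h i)\<^sup>2) powr (p / 2) \<le> Cfun d p * a * Q + E"
    using powr_of_noise_bound[OF p d(2) _ _ noise _ _ _ Q0[unfolded Q_def] b1] g d k
    by (simp add: sum_nonneg Cfun_eq[OF p] a_def E_def Q_def exps)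
  have norm: "norm2 n h powr p \<le> Dfun d p * a * Q + 2 powr p * \<epsilon> powr p / (1 - d) powr (p / 2)"
  proof -
    have "((norm2 n h)\<^sup>2) powr (p / 2) \<le> Dfun d p * a * Q + 2 powr p * \<epsilon> powr p / (1 - d) powr (p / 2)"
      using powr_of_noise_bound[OF p d(2) _ _ noise _ _ _ Q0[unfolded Q_def], of _ 1] b2 g d k
      by (simp add: Dfun_eq[OF p] a_def Q_def)
    moreover have "((norm2 n h)\<^sup>2) powr (p / 2) = norm2 n h powr p"
      by (cases "norm2 n h = 0") (simp_all add: powr_powr less_le flip: powr_numeral)
    ultimately show ?thesis
      by simp
  qed
  have "finite K"
    using K finite_subset by blast
  then have "P \<le> real k powr (1 - p / 2) * (\<Sum>i\<in>K. (h i)\<^sup>2) powr (p / 2)"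
    unfolding P_def using sum_powr_le_L2[of p K h] p k K by simp
  also have "\<dots> \<le> real k powr (1 - p / 2) * (Cfun d p * a * Q + E)"
    using U by (intro mult_left_mono) auto
  finally have "a * P \<le> a * (real k powr (1 - p / 2) * (Cfun d p * a * Q + E))"
    using a by (intro mult_left_mono) auto
  also have "\<dots> = (real k powr (1 - p / 2) * a) * (Cfun d p * a * Q + E)"
    by (simp add: algebra_simps)
  also have "\<dots> = Cfun d p * a * Q + E"
    by (simp add: a)
  finally have "a * P \<le> Cfun d p * a * Q + E" .
  \<comment> \<open>The head is bounded by the tail and the tail by the head;
    \<open>Cfun d p < 1\<close> lets this loop be solved for \<open>a * Q\<close>.\<close>
  moreover have "a * Q \<le> a * (P + 2 * X)"
    using cone a by (intro mult_left_mono) auto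
  ultimately have "(1 - Cfun d p) * (a * Q) \<le> 2 * a * X + E"
    by (simp add: algebra_simps)
  then have "a * Q \<le> (2 * a * X + E) / (1 - Cfun d p)"
    using C by (simp add: field_simps)
  moreover have "0 \<le> Dfun d p"
    by (simp add: Dfun_def)
  ultimately have "Dfun d p * (a * Q) \<le> Dfun d p * ((2 * a * X + E) / (1 - Cfun d p))"
    by (intro mult_left_mono)
  with norm have "norm2 n h powr p \<le> Dfun d p * ((2 * a * X + E) / (1 - Cfun d p))
      + 2 powr p * \<epsilon> powr p / (1 - d) powr (p / 2)"
    by (simp add: mult.assoc)
  also have "\<dots> = 2 * Dfun d p / (1 - Cfun d p) * a * X
      + 1 / (1 - d) powr (p / 2) * (2 powr p + 2 powr (3 * p / 2) * Dfun d p / (1 - Cfun d p)) * \<epsilon> powr p"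
    by (simp add: E_def add_divide_distrib algebra_simps)
  finally show ?thesis
    by (simp add: a_def X_def)
qed

theorem theorem2:
  fixes k l m n :: nat and A :: "nat \<Rightarrow> nat \<Rightarrow> real"
    and x e :: "nat \<Rightarrow> real" and \<epsilon> :: real
  assumes "k > 0" "l > 0" "m > 0" "n = (l + 1) * k"
    and "sqrt 2 / 2 \<le> rip_const m n A (2 * k)" "rip_const m n A (2 * k) < 1"
    and "\<epsilon> \<ge> 0" "norm2 m e \<le> \<epsilon>"
  shows "\<forall>p xstar. 0 < p \<and> p < 1 \<and>
           norm2 m (\<lambda>j. matvec m n A x j + e j - matvec m n A xstar j) \<le> \<epsilon> \<and>
           (\<forall>\<gamma>. norm2 m (\<lambda>j. matvec m n A x j + e j - matvec m n A \<gamma> j) \<le> \<epsilon>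
                 \<longrightarrow> pnorm p n xstar \<le> pnorm p n \<gamma>) \<and>
           Cfun (rip_const m n A (2 * k)) p < 1
         \<longrightarrow>
           (norm2 n (\<lambda>i. x i - xstar i)) powr p
             \<le> 2 * Dfun (rip_const m n A (2 * k)) p / (1 - Cfun (rip_const m n A (2 * k)) p)
                 * real k powr (p / 2 - 1) * (\<Sum>i\<in>{k..<n}. \<bar>x i\<bar> powr p)
               + 1 / (1 - rip_const m n A (2 * k)) powr (p / 2)
                 * (2 powr p + 2 powr (3 * p / 2) * Dfun (rip_const m n A (2 * k)) p
                      / (1 - Cfun (rip_const m n A (2 * k)) p))
                 * \<epsilon> powr p
           \<and> (\<epsilon> = 0 \<and> sparse k n x \<longrightarrow> (\<forall>i<n. xstar i = x i))"
proof (intro allI impI, elim conjE)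
  fix p xstar
  assume p: "0 < p" "p < 1"
    and feasible: "norm2 m (\<lambda>j. matvec m n A x j + e j - matvec m n A xstar j) \<le> \<epsilon>"
    and optimal: "\<forall>\<gamma>. norm2 m (\<lambda>j. matvec m n A x j + e j - matvec m n A \<gamma> j) \<le> \<epsilon>
        \<longrightarrow> pnorm p n xstar \<le> pnorm p n \<gamma>"
    and C: "Cfun (rip_const m n A (2 * k)) p < 1"
  define d where "d = rip_const m n A (2 * k)"
  define h where "h i = x i - xstar i" for i
  have "1 \<le> sqrt 2"
    by simp
  then have d: "1 / 2 \<le> d" "d < 1"
    using assms(5,6) unfolding d_def by linarith+
  have rip: "rip m n A (2 * k) d"
    unfolding d_def using assms by (intro rip_rip_const) auto
  \<comment> \<open>The image of the error is the residual of \<open>xstar\<close> minus the noise,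
    each of norm at most \<epsilon>.\<close>
  have "matvec m n A h = (\<lambda>j. matvec m n A x j + e j - matvec m n A xstar j + - e j)"
    by (simp add: h_def[abs_def] matvec_diff)
  then have "norm2 m (matvec m n A h) \<le> \<epsilon> + \<epsilon>"
    using norm2_triangle[of m "\<lambda>j. matvec m n A x j + e j - matvec m n A xstar j" "\<lambda>j. - e j"]
      feasible assms(8) by (simp add: norm2_minus)
  then have noise: "norm2 m (matvec m n A h) \<le> 2 * \<epsilon>"
    by simp
  \<comment> \<open>\<open>x\<close> itself is feasible, its residual being
    \<open>e\<close>.\<close>
  have "pnorm p n xstar \<le> pnorm p n x"
    using optimal assms(8) by simp
  then have "pnorm p n xstar powr p \<le> pnorm p n x powr p"
    using p by (intro powr_mono2) (simp_all add: pnorm_def)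
  then have min: "(\<Sum>i<n. \<bar>x i - h i\<bar> powr p) \<le> (\<Sum>i<n. \<bar>x i\<bar> powr p)"
    using p by (simp add: pnorm_def powr_powr sum_nonneg h_def)
  note bound = recovery_bound[OF p assms(1,2,4) rip d C[folded d_def] noise min]
  have "{..<n} - {..<k} = {k..<n}" "k \<le> n"
    using assms by auto
  then have "norm2 n h powr p
    \<le> 2 * Dfun d p / (1 - Cfun d p) * real k powr (p / 2 - 1) * (\<Sum>i\<in>{k..<n}. \<bar>x i\<bar> powr p)
      + 1 / (1 - d) powr (p / 2) * (2 powr p + 2 powr (3 * p / 2) * Dfun d p / (1 - Cfun d p)) * \<epsilon> powr p"
    using bound[of "{..<k}"] by simp
  moreover have "\<forall>i<n. xstar i = x i" if "\<epsilon> = 0" "sparse k n x"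
  proof -
    \<comment> \<open>A sparse \<open>x\<close> may live on any \<open>k\<close> positions, so its
      support replaces the initial segment; both terms of the bound then vanish, since
      \<open>0 powr p = 0\<close>.\<close>
    define S where "S = {i \<in> {..<n}. x i \<noteq> 0}"
    have "S \<subseteq> {..<n}" "card S \<le> k"
      using that by (auto simp: S_def sparse_def)
    moreover have "(\<Sum>i\<in>{..<n} - S. \<bar>x i\<bar> powr p) = 0"
      by (intro sum.neutral) (auto simp: S_def)
    ultimately have "norm2 n h powr p \<le> 0"
      using bound[of S] that(1) by simp
    then have "norm2 n h = 0"
      using powr_gt_zero[of "norm2 n h" p] by simp
    then show ?thesis
      by (auto simp: norm2_L2_set L2_set_eq_0_iff h_def)
  qed
  ultimately show "(norm2 n (\<lambda>i. x i - xstar i)) powr p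
             \<le> 2 * Dfun (rip_const m n A (2 * k)) p / (1 - Cfun (rip_const m n A (2 * k)) p)
                 * real k powr (p / 2 - 1) * (\<Sum>i\<in>{k..<n}. \<bar>x i\<bar> powr p)
               + 1 / (1 - rip_const m n A (2 * k)) powr (p / 2)
                 * (2 powr p + 2 powr (3 * p / 2) * Dfun (rip_const m n A (2 * k)) p
                      / (1 - Cfun (rip_const m n A (2 * k)) p))
                 * \<epsilon> powr p
           \<and> (\<epsilon> = 0 \<and> sparse k n x \<longrightarrow> (\<forall>i<n. xstar i = x i))"
    unfolding d_def h_def[abs_def] by blast
qed

end
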